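(* Let $n\geq 1$ and let $\lambda,\mu\in\mathcal P_n$. If $\lambda\supseteq\mu$ (i.e. $\lambda_i\geq\mu_i$ for $1\leq i\leq n$), then $\binom{\lambda}{\nu}_\tau-\binom{\mu}{\nu}_\tau\in\mathbb F_{\geq 0}$ for all $\nu\in\mathcal P_n$.
   Context: $\mathcal P_n$ is the set of partitions of length at most $n$, i.e. tuples $\lambda=(\lambda_1,\dots,\lambda_n)\in\mathbb Z^n$ with $\lambda_1\geq\cdots\geq\lambda_n\geq 0$; $|\lambda|=\lambda_1+\cdots+\lambda_n$. Base field and cone: $\mathbb F=\mathbb Q(\tau)$ with $\tau$ an indeterminate, and $\mathbb F_{\geq 0}=\{f/g : f,g\in\mathbb Z_{\geq 0}[\tau],\ g\neq 0\}\subset\mathbb F$. For $\lambda\in\mathcal P_n$ let $\overline\lambda\in\mathbb F^n$ be given by $\overline\lambda_i=\lambda_i+(n-i)\tau$. For $\mu\in\mathcal P_n$, the (unital) interpolation Jack polynomial $h_\mu(x;\tau)\in\mathbb F[x_1,\dots,x_n]^{S_n}$ is the unique symmetric polynomial of degree $|\mu|$ such that $h_\mu(\overline\lambda;\tau)=\delta_{\lambda\mu}$ for all $\lambda\in\mathcal P_n$ with $|\lambda|\leq|\mu|$. (Existence and uniqueness are known: for every $d\geq 0$ and every function $\overline f:\{\lambda\in\mathcal P_n : |\lambda|\leq d\}\to\mathbb F$ there is a unique symmetric polynomial $f$ over $\mathbb F$ of degree at most $d$ with $f(\overline\lambda)=\overline f(\lambda)$ for all $|\lambda|\leq d$.) The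 generalized binomial coefficients are $\binom{\lambda}{\mu}_\tau:=h_\mu(\overline\lambda;\tau)\in\mathbb F$ for $\lambda,\mu\in\mathcal P_n$. *)

theory Defs
  imports "HOL-Library.Poly_Mapping" "HOL-Computational_Algebra.Polynomial"
    "HOL-Computational_Algebra.Fraction_Field" "HOL-Combinatorics.Permutations"
begin

type_synonym base_field = "rat poly fract"

definition tau :: base_field where
  "tau = Fract [:0, 1:] 1"

text \<open>Polynomials in \<open>\<int>\<^sub>\<ge>\<^sub>0[\<tau>]\<close> are represented by the type \<^typ>\<open>nat poly\<close>.\<close>

definition nonneg_cone :: "base_field set" where
  "nonneg_cone =
     {Fract (map_poly of_nat f) (map_poly of_nat g) | (f :: nat poly) (g :: nat poly). g \<noteq> 0}"

text \<open>An \<open>n\<close>-tuple is a function on the index set \<open>{1..n}\<close>. Partitions are extended by \<open>0\<close>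
  outside this set, so that equality of functions is equality of tuples.\<close>

definition partitions :: "nat \<Rightarrow> (nat \<Rightarrow> nat) set" where
  "partitions n =
     {l. (\<forall>i j. 1 \<le> i \<and> i \<le> j \<and> j \<le> n \<longrightarrow> l j \<le> l i) \<and> (\<forall>i. i \<notin> {1..n} \<longrightarrow> l i = 0)}"

definition psize :: "nat \<Rightarrow> (nat \<Rightarrow> nat) \<Rightarrow> nat" where
  "psize n l = (\<Sum>i=1..n. l i)"

definition shifted :: "nat \<Rightarrow> (nat \<Rightarrow> nat) \<Rightarrow> nat \<Rightarrow> base_field" where
  "shifted n l i = of_nat (l i) + of_nat (n - i) * tau"

text \<open>A multivariate polynomial is a finitely supported map from monomials to coefficients,
  a monomial being a finitely supported map from variable indices to exponents.\<close>

type_synonym 'a mpoly = "(nat \<Rightarrow>\<^sub>0 nat) \<Rightarrow>\<^sub>0 'a"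

definition mpoly_eval :: "(nat \<Rightarrow> 'a) \<Rightarrow> 'a::comm_semiring_1 mpoly \<Rightarrow> 'a" where
  "mpoly_eval x p = (\<Sum>m\<in>Poly_Mapping.keys p.
     Poly_Mapping.lookup p m * (\<Prod>i\<in>Poly_Mapping.keys m. x i ^ Poly_Mapping.lookup m i))"

definition monom_degree :: "(nat \<Rightarrow>\<^sub>0 nat) \<Rightarrow> nat" where
  "monom_degree m = (\<Sum>i\<in>Poly_Mapping.keys m. Poly_Mapping.lookup m i)"

text \<open>The zero polynomial gets degree \<open>0\<close>.\<close>

definition total_degree :: "'a::zero mpoly \<Rightarrow> nat" where
  "total_degree p = Max (insert 0 (monom_degree ` Poly_Mapping.keys p))"

text \<open>For an injective \<open>\<pi>\<close>, \<^term>\<open>Poly_Mapping.map_key \<pi> m\<close> has the exponent of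
  \<open>x\<^bsub>\<pi>(i)\<^esub>\<close> in \<open>m\<close> as its exponent of \<open>x\<^bsub>i\<^esub>\<close>.\<close>

definition sym_polys :: "nat \<Rightarrow> 'a::zero mpoly set" where
  "sym_polys n =
     {p. (\<forall>m\<in>Poly_Mapping.keys p. Poly_Mapping.keys m \<subseteq> {1..n}) \<and>
         (\<forall>\<pi>. \<pi> permutes {1..n} \<longrightarrow>
            (\<forall>m. Poly_Mapping.lookup p (Poly_Mapping.map_key \<pi> m) = Poly_Mapping.lookup p m))}"

definition interp_jack :: "nat \<Rightarrow> (nat \<Rightarrow> nat) \<Rightarrow> base_field mpoly" where
  "interp_jack n mu = (THE h. h \<in> sym_polys n \<and> total_degree h = psize n mu \<and>
     (\<forall>lam\<in>partitions n. psize n lam \<le> psize n mu \<longrightarrow>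
        mpoly_eval (shifted n lam) h = (if lam = mu then 1 else 0)))"

definition gen_binom :: "nat \<Rightarrow> (nat \<Rightarrow> nat) \<Rightarrow> (nat \<Rightarrow> nat) \<Rightarrow> base_field" where
  "gen_binom n lam mu = mpoly_eval (shifted n lam) (interp_jack n mu)"

end

theory Submission
  imports Defs
begin

text \<open>Write \<open>x\<close> for the shifted partition \<open>shifted n \<lambda>\<close> and put
  \<open>a\<^sub>i(x) = x\<^sub>i \<Prod>\<^bsub>j \<noteq> i\<^esub> (x\<^sub>i - x\<^sub>j - \<tau>) / (x\<^sub>i - x\<^sub>j)\<close>.
  The difference operator \<open>E f (x) = \<Sum>\<^sub>i a\<^sub>i(x) (f(x) - f(x - e\<^sub>i))\<close> has the interpolation
  polynomials as eigenfunctions. Indeed \<open>E\<close> maps symmetric polynomials of degree at most \<open>d\<close> to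
  such polynomials; \<open>a\<^sub>i\<close> vanishes at a shifted partition unless the last box of row \<open>i\<close> can be
  removed; and the \<open>a\<^sub>i\<close> add up to \<open>|\<lambda>|\<close> there. Hence \<open>E h\<^sub>\<nu>\<close> and \<open>|\<nu>| h\<^sub>\<nu>\<close> agree at all
  partitions of size at most \<open>|\<nu>|\<close>, so they are equal. Evaluated at an arbitrary \<open>\<lambda>\<close> this is
  the recursion (\<open>gen_binom_recursion\<close>), in which \<open>B\<close> denotes the generalized binomial coefficient:

    \<open>(|\<lambda>| - |\<nu>|) B(\<lambda>,\<nu>) = \<Sum>\<^sub>i a\<^sub>i(\<lambda>) B(\<lambda> - e\<^sub>i, \<nu>)\<close>.

  It suffices to compare \<open>\<lambda>\<close> with \<open>\<kappa> = \<lambda> - e\<^sub>p\<close>, since \<open>\<mu>\<close> is reached from \<open>\<lambda>\<close> by removing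
  boxes one at a time. With \<open>f = B(\<cdot>,\<nu>)\<close> and \<open>k = |\<lambda>| - |\<nu>|\<close>, the recursions at \<open>\<lambda>\<close> and \<open>\<kappa>\<close>,
  together with \<open>\<Sum>\<^sub>i a\<^sub>i(\<lambda>) = |\<lambda>| = \<Sum>\<^sub>i a\<^sub>i(\<kappa>) + 1\<close>, give

    \<open>k (f(\<lambda>) - f(\<kappa>)) = \<Sum>\<^sub>i (a\<^sub>i(\<lambda>) (f(\<lambda> - e\<^sub>i) - f(\<kappa>)) + a\<^sub>i(\<kappa>) (f(\<kappa>) - f(\<kappa> - e\<^sub>i)))\<close>,

  and for \<open>i \<noteq> p\<close> the \<open>i\<close>-th summand can be regrouped as

    \<open>a\<^sub>i(\<lambda>) (f(\<lambda> - e\<^sub>i) - f(\<kappa> - e\<^sub>i)) + (a\<^sub>i(\<kappa>) - a\<^sub>i(\<lambda>)) (f(\<kappa>) - f(\<kappa> - e\<^sub>i))\<close>.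

  By induction on \<open>|\<lambda>|\<close> everything is in the cone, because \<open>a\<^sub>i(\<lambda>)\<close> is (\<open>cone_weight\<close>) and because
  removing a box from another row increases \<open>a\<^sub>i\<close> (\<open>cone_weight_remove_box_diff\<close>).

  Two foundations are needed. Interpolation: there is a family of symmetric polynomials that is
  triangular for the lexicographic order reading partitions from the last row
  (\<open>ex_triangular_sym_fun\<close>), which gives existence; uniqueness follows by counting dimensions,
  since a symmetric polynomial of degree at most \<open>d\<close> is determined by its coefficients at the
  monomials that are partitions of size at most \<open>d\<close> (\<open>sym_poly_vanishing_eq_0\<close>). Polynomiality of
  \<open>E f\<close>: this is \<open>sym_fun_lowering\<close>, where the denominators are cleared by the identity expressing
  \<open>\<Sum>\<^sub>i x\<^sub>i\<^sup>k / \<Prod>\<^bsub>j \<noteq> i\<^esub> (x\<^sub>i - x\<^sub>j)\<close> as a symmetric polynomial of degree \<open>k + 1 - n\<close>.\<close>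

section \<open>Evaluation and degree of multivariate polynomials\<close>

definition monom_eval :: "(nat \<Rightarrow> 'a) \<Rightarrow> (nat \<Rightarrow>\<^sub>0 nat) \<Rightarrow> 'a::comm_semiring_1" where
  "monom_eval x m = (\<Prod>i\<in>Poly_Mapping.keys m. x i ^ Poly_Mapping.lookup m i)"

lemma monom_eval_superset:
  assumes "finite A" and "Poly_Mapping.keys m \<subseteq> A"
  shows "monom_eval x m = (\<Prod>i\<in>A. x i ^ Poly_Mapping.lookup m i)"
  unfolding monom_eval_def
  by (rule prod.mono_neutral_left) (use assms in \<open>auto simp: in_keys_iff\<close>)

lemma monom_eval_0 [simp]: "monom_eval x 0 = 1"
  by (simp add: monom_eval_def)

lemma monom_eval_add: "monom_eval x (m + m') = monom_eval x m * monom_eval x m'"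
proof -
  let ?A = "Poly_Mapping.keys m \<union> Poly_Mapping.keys m'"
  have "monom_eval x (m + m') = (\<Prod>i\<in>?A. x i ^ Poly_Mapping.lookup (m + m') i)"
    by (rule monom_eval_superset) (use Poly_Mapping.keys_add[of m m'] in auto)
  also have "\<dots> = (\<Prod>i\<in>?A. x i ^ Poly_Mapping.lookup m i) * (\<Prod>i\<in>?A. x i ^ Poly_Mapping.lookup m' i)"
    by (simp add: lookup_add power_add prod.distrib)
  also have "\<dots> = monom_eval x m * monom_eval x m'"
    by (simp add: monom_eval_superset[of ?A])
  finally show ?thesis .
qed

lemma mpoly_eval_superset:
  assumes "finite K" and "Poly_Mapping.keys p \<subseteq> K"
  shows "mpoly_eval x p = (\<Sum>m\<in>K. Poly_Mapping.lookup p m * monom_eval x m)"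
  unfolding mpoly_eval_def monom_eval_def
  by (rule sum.mono_neutral_left) (use assms in \<open>auto simp: in_keys_iff\<close>)

lemma mpoly_eval_0 [simp]: "mpoly_eval x 0 = 0"
  by (simp add: mpoly_eval_def)

lemma mpoly_eval_add: "mpoly_eval x (p + q) = mpoly_eval x p + mpoly_eval x q"
proof -
  let ?K = "Poly_Mapping.keys p \<union> Poly_Mapping.keys q"
  have "mpoly_eval x (p + q) = (\<Sum>m\<in>?K. Poly_Mapping.lookup (p + q) m * monom_eval x m)"
    by (rule mpoly_eval_superset) (use Poly_Mapping.keys_add[of p q] in auto)
  then show ?thesis
    by (simp add: mpoly_eval_superset[of ?K] lookup_add algebra_simps sum.distrib)
qed

lemma mpoly_eval_sum: "mpoly_eval x (\<Sum>i\<in>I. p i) = (\<Sum>i\<in>I. mpoly_eval x (p i))"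
  by (induction I rule: infinite_finite_induct) (auto simp: mpoly_eval_add)

lemma mpoly_eval_single: "mpoly_eval x (Poly_Mapping.single m c) = c * monom_eval x m"
  by (cases "c = 0") (auto simp: mpoly_eval_def monom_eval_def)

lemma mpoly_decomp:
  "p = (\<Sum>m\<in>Poly_Mapping.keys p. Poly_Mapping.single m (Poly_Mapping.lookup p m))"
  by (rule poly_mapping_eqI)
    (auto simp: lookup_sum lookup_single when_def sum.delta in_keys_iff)

lemma mpoly_eval_mult: "mpoly_eval x (p * q) = mpoly_eval x p * mpoly_eval x q"
proof -
  let ?S = "\<lambda>p. (\<Sum>m\<in>Poly_Mapping.keys p. Poly_Mapping.single m (Poly_Mapping.lookup p m))"
  have "p * q = ?S p * ?S q"
    using mpoly_decomp[of p] mpoly_decomp[of q] by simp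
  also have "\<dots> = (\<Sum>a\<in>Poly_Mapping.keys p. \<Sum>b\<in>Poly_Mapping.keys q.
      Poly_Mapping.single (a + b) (Poly_Mapping.lookup p a * Poly_Mapping.lookup q b))"
    by (simp add: sum_product mult_single)
  finally have "p * q = \<dots>" .
  then have "mpoly_eval x (p * q) = (\<Sum>a\<in>Poly_Mapping.keys p. \<Sum>b\<in>Poly_Mapping.keys q.
      (Poly_Mapping.lookup p a * Poly_Mapping.lookup q b) * (monom_eval x a * monom_eval x b))"
    by (simp add: mpoly_eval_sum mpoly_eval_single monom_eval_add)
  also have "\<dots> = mpoly_eval x p * mpoly_eval x q"
    by (simp add: mpoly_eval_superset[of "Poly_Mapping.keys p" p]
        mpoly_eval_superset[of "Poly_Mapping.keys q" q] sum_product algebra_simps)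
  finally show ?thesis .
qed

lemma total_degree_le_iff:
  "total_degree p \<le> d \<longleftrightarrow> (\<forall>m\<in>Poly_Mapping.keys p. monom_degree m \<le> d)"
  by (simp add: total_degree_def)

lemma monom_degree_superset:
  assumes "finite A" and "Poly_Mapping.keys m \<subseteq> A"
  shows "monom_degree m = (\<Sum>i\<in>A. Poly_Mapping.lookup m i)"
  unfolding monom_degree_def
  by (rule sum.mono_neutral_left) (use assms in \<open>auto simp: in_keys_iff\<close>)

lemma monom_degree_add: "monom_degree (m + m') = monom_degree m + monom_degree m'"
proof -
  let ?A = "Poly_Mapping.keys m \<union> Poly_Mapping.keys m'"
  have "monom_degree (m + m') = (\<Sum>i\<in>?A. Poly_Mapping.lookup (m + m') i)"
    by (rule monom_degree_superset) (use Poly_Mapping.keys_add[of m m'] in auto)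
  then show ?thesis
    by (simp add: monom_degree_superset[of ?A] lookup_add sum.distrib)
qed

lemma total_degree_add_le:
  "total_degree p \<le> d \<Longrightarrow> total_degree q \<le> d \<Longrightarrow> total_degree (p + q) \<le> d"
  using Poly_Mapping.keys_add[of p q] by (auto simp: total_degree_le_iff)

lemma total_degree_mult_le:
  assumes "total_degree p \<le> a" and "total_degree q \<le> b"
  shows "total_degree (p * q) \<le> a + b"
  unfolding total_degree_le_iff
proof
  fix m assume "m \<in> Poly_Mapping.keys (p * q)"
  then obtain k l where "m = k + l" "k \<in> Poly_Mapping.keys p" "l \<in> Poly_Mapping.keys q"
    using Poly_Mapping.keys_mult[of p q] by blast
  then show "monom_degree m \<le> a + b"
    using assms by (auto simp: total_degree_le_iff monom_degree_add intro!: add_mono)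
qed

section \<open>Symmetric polynomials\<close>

lemma sym_polysI:
  assumes "\<And>m. Poly_Mapping.lookup p m \<noteq> 0 \<Longrightarrow> Poly_Mapping.keys m \<subseteq> {1..n}"
    and "\<And>\<pi> m. \<pi> permutes {1..n} \<Longrightarrow>
      Poly_Mapping.lookup p (Poly_Mapping.map_key \<pi> m) = Poly_Mapping.lookup p m"
  shows "p \<in> sym_polys n"
  using assms by (auto simp: sym_polys_def in_keys_iff)

lemma sym_polys_keys:
  "p \<in> sym_polys n \<Longrightarrow> Poly_Mapping.lookup p m \<noteq> 0 \<Longrightarrow> Poly_Mapping.keys m \<subseteq> {1..n}"
  by (auto simp: sym_polys_def in_keys_iff)

lemma sym_polys_perm:
  "p \<in> sym_polys n \<Longrightarrow> \<pi> permutes {1..n} \<Longrightarrow>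
    Poly_Mapping.lookup p (Poly_Mapping.map_key \<pi> m) = Poly_Mapping.lookup p m"
  by (auto simp: sym_polys_def)

lemma lookup_map_key: "inj f \<Longrightarrow> Poly_Mapping.lookup (Poly_Mapping.map_key f p) i = Poly_Mapping.lookup p (f i)"
  by (simp add: Poly_Mapping.map_key.rep_eq)

lemma bij_map_key:
  fixes \<pi> :: "nat \<Rightarrow> nat"
  assumes "bij \<pi>"
  shows "bij (Poly_Mapping.map_key \<pi> :: (nat \<Rightarrow>\<^sub>0 nat) \<Rightarrow> _)"
proof (rule o_bij)
  have i: "inj \<pi>" "inj (inv \<pi>)"
    using assms by (auto simp: bij_is_inj bij_imp_bij_inv)
  show "Poly_Mapping.map_key (inv \<pi>) \<circ> Poly_Mapping.map_key \<pi> = (id :: (nat \<Rightarrow>\<^sub>0 nat) \<Rightarrow> _)"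
    using i assms by (auto simp: fun_eq_iff lookup_map_key bij_is_surj surj_f_inv_f intro!: poly_mapping_eqI)
  show "Poly_Mapping.map_key \<pi> \<circ> Poly_Mapping.map_key (inv \<pi>) = (id :: (nat \<Rightarrow>\<^sub>0 nat) \<Rightarrow> _)"
    using i assms by (auto simp: fun_eq_iff lookup_map_key bij_is_surj inv_f_f intro!: poly_mapping_eqI)
qed

lemma sym_polys_add:
  assumes "p \<in> sym_polys n" and "q \<in> sym_polys n"
  shows "p + q \<in> sym_polys n"
proof (rule sym_polysI)
  fix m assume "Poly_Mapping.lookup (p + q) m \<noteq> 0"
  then have "Poly_Mapping.lookup p m \<noteq> 0 \<or> Poly_Mapping.lookup q m \<noteq> 0"
    by (auto simp: lookup_add)
  then show "Poly_Mapping.keys m \<subseteq> {1..n}"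
    using assms sym_polys_keys by blast
qed (simp add: lookup_add sym_polys_perm[OF assms(1)] sym_polys_perm[OF assms(2)])

lemma sym_polys_single_0: "Poly_Mapping.single 0 c \<in> sym_polys n"
proof (rule sym_polysI)
  fix \<pi> and m :: "nat \<Rightarrow>\<^sub>0 nat" assume "\<pi> permutes {1..n}"
  then have "bij \<pi>"
    by (rule permutes_bij)
  then have "0 = Poly_Mapping.map_key \<pi> m \<longleftrightarrow> 0 = m"
    using bij_map_key[of \<pi>] map_key_zero[OF bij_is_inj[of \<pi>]]
    by (metis bij_is_inj injD)
  then show "Poly_Mapping.lookup (Poly_Mapping.single 0 c) (Poly_Mapping.map_key \<pi> m)
      = Poly_Mapping.lookup (Poly_Mapping.single 0 c) m"
    by (simp add: lookup_single when_def)
qed (auto simp: lookup_single when_def split: if_splits)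

text \<open>Renaming variables is an additive bijection on monomials, so it can be used to reindex both sums
  in the convolution that defines the product.\<close>
lemma sym_polys_mult:
  fixes p q :: "'a::comm_semiring_0 mpoly"
  assumes p: "p \<in> sym_polys n" and q: "q \<in> sym_polys n"
  shows "p * q \<in> sym_polys n"
proof (rule sym_polysI)
  fix m assume "Poly_Mapping.lookup (p * q) m \<noteq> 0"
  then obtain k l where kl: "m = k + l" "k \<in> Poly_Mapping.keys p" "l \<in> Poly_Mapping.keys q"
    using Poly_Mapping.keys_mult[of p q] unfolding in_keys_iff[symmetric] by blast
  then have "Poly_Mapping.keys k \<subseteq> {1..n}" "Poly_Mapping.keys l \<subseteq> {1..n}"
    using p q by (simp_all add: sym_polys_def)
  then show "Poly_Mapping.keys m \<subseteq> {1..n}"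
    using Poly_Mapping.keys_add[of k l] kl(1) by blast
next
  fix \<pi> and m :: "nat \<Rightarrow>\<^sub>0 nat" assume \<pi>: "\<pi> permutes {1..n}"
  let ?s = "Poly_Mapping.map_key \<pi> :: (nat \<Rightarrow>\<^sub>0 nat) \<Rightarrow> _"
  have i: "inj \<pi>" and b: "bij ?s"
    using permutes_inj[OF \<pi>] bij_map_key[OF permutes_bij[OF \<pi>]] by auto
  have eq: "?s m = ?s k + ?s l \<longleftrightarrow> m = k + l" for k l
    using b i by (metis bij_is_inj injD map_key_plus)
  have "Poly_Mapping.lookup (p * q) (?s m)
      = (\<Sum>k. Poly_Mapping.lookup p k * (\<Sum>l. Poly_Mapping.lookup q l when ?s m = k + l))"
    by (rule lookup_mult)
  also have "\<dots> = (\<Sum>k. Poly_Mapping.lookup p (?s k) * (\<Sum>l. Poly_Mapping.lookup q l when ?s m = ?s k + l))"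
    by (rule Sum_any.reindex_cong[OF b]) (simp add: fun_eq_iff)
  also have "\<dots> = (\<Sum>k. Poly_Mapping.lookup p (?s k) *
      (\<Sum>l. Poly_Mapping.lookup q (?s l) when ?s m = ?s k + ?s l))"
    by (intro Sum_any.cong arg_cong2[of _ _ _ _ "(*)"] refl Sum_any.reindex_cong[OF b])
      (simp add: fun_eq_iff)
  also have "\<dots> = Poly_Mapping.lookup (p * q) m"
    by (simp add: eq lookup_mult sym_polys_perm[OF p \<pi>] sym_polys_perm[OF q \<pi>])
  finally show "Poly_Mapping.lookup (p * q) (?s m) = Poly_Mapping.lookup (p * q) m" .
qed

section \<open>Elementary symmetric functions\<close>

definition esym :: "nat set \<Rightarrow> nat \<Rightarrow> (nat \<Rightarrow> 'a) \<Rightarrow> 'a::comm_semiring_1" where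
  "esym A k x = (\<Sum>S | S \<subseteq> A \<and> card S = k. \<Prod>i\<in>S. x i)"

text \<open>The coefficient of the elementary symmetric polynomial at a monomial is \<open>1\<close> or \<open>0\<close>, and which of
  the two depends only on the number of variables in the monomial and on its exponents being at most
  \<open>1\<close>; hence the invariance under permutations.\<close>
lemma ex_sym_poly_esym:
  "\<exists>p\<in>sym_polys n. total_degree p \<le> k \<and> (\<forall>x. mpoly_eval x p = esym {1..n} k x)"
proof -
  define mon :: "nat set \<Rightarrow> nat \<Rightarrow>\<^sub>0 nat" where "mon S = (\<Sum>i\<in>S. Poly_Mapping.single i 1)" for S
  define Q where "Q = {S. S \<subseteq> {1..n} \<and> card S = k}"
  define p where "p = (\<Sum>S\<in>Q. Poly_Mapping.single (mon S) (1::'a))"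
  have fin: "finite S" if "S \<in> Q" for S
    using that by (auto simp: Q_def intro: finite_subset)
  have "finite Q"
    by (rule finite_subset[of _ "Pow {1..n}"]) (auto simp: Q_def)
  have lmon: "Poly_Mapping.lookup (mon S) i = (if i \<in> S then 1 else 0)" if "finite S" for S i
    using that by (auto simp: mon_def lookup_sum lookup_single when_def sum.delta)
  have kmon: "Poly_Mapping.keys (mon S) = S" if "finite S" for S
    using that by (auto simp: in_keys_iff lmon split: if_splits)
  have mon_iff: "S \<in> Q \<and> mon S = m \<longleftrightarrow>
      Poly_Mapping.keys m \<in> Q \<and> (\<forall>i. Poly_Mapping.lookup m i \<le> 1) \<and> S = Poly_Mapping.keys m"
    for S m
  proof
    assume S: "S \<in> Q \<and> mon S = m"
    then have "Poly_Mapping.keys m = S" "\<And>i. Poly_Mapping.lookup m i = (if i \<in> S then 1 else 0)"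
      using kmon[of S] lmon[of S] fin[of S] by blast+
    with S show "Poly_Mapping.keys m \<in> Q \<and> (\<forall>i. Poly_Mapping.lookup m i \<le> 1) \<and> S = Poly_Mapping.keys m"
      by simp
  next
    assume A: "Poly_Mapping.keys m \<in> Q \<and> (\<forall>i. Poly_Mapping.lookup m i \<le> 1) \<and> S = Poly_Mapping.keys m"
    have "mon S = m"
    proof (rule poly_mapping_eqI)
      fix i
      have "Poly_Mapping.lookup m i \<le> 1" and "finite S"
        using A fin by blast+
      moreover have "i \<in> S \<longleftrightarrow> Poly_Mapping.lookup m i \<noteq> 0"
        using A by (simp add: in_keys_iff)
      ultimately show "Poly_Mapping.lookup (mon S) i = Poly_Mapping.lookup m i"
        by (simp add: lmon)
    qed
    with A show "S \<in> Q \<and> mon S = m" by simp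
  qed
  have lp: "Poly_Mapping.lookup p m =
      (if Poly_Mapping.keys m \<in> Q \<and> (\<forall>i. Poly_Mapping.lookup m i \<le> 1) then 1 else 0)" for m
  proof -
    have "Poly_Mapping.lookup p m = (\<Sum>S\<in>Q. if S \<in> Q \<and> mon S = m then 1 else 0)"
      unfolding p_def lookup_sum by (rule sum.cong) (simp_all add: lookup_single when_def)
    also have "\<dots> = (\<Sum>S\<in>Q. if S = Poly_Mapping.keys m then
        if \<forall>i. Poly_Mapping.lookup m i \<le> 1 then 1 else 0 else 0)"
      unfolding mon_iff by (rule sum.cong) auto
    also have "\<dots> = (if Poly_Mapping.keys m \<in> Q \<and> (\<forall>i. Poly_Mapping.lookup m i \<le> 1) then 1 else 0)"
      using \<open>finite Q\<close> by (subst sum.delta) auto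
    finally show ?thesis .
  qed
  have "p \<in> sym_polys n"
  proof (rule sym_polysI)
    fix m assume "Poly_Mapping.lookup p m \<noteq> 0"
    then show "Poly_Mapping.keys m \<subseteq> {1..n}"
      unfolding lp Q_def by (simp split: if_splits)
  next
    fix \<pi> and m :: "nat \<Rightarrow>\<^sub>0 nat" assume \<pi>: "\<pi> permutes {1..n}"
    have keys: "Poly_Mapping.keys (Poly_Mapping.map_key \<pi> m) = inv \<pi> ` Poly_Mapping.keys m"
      using permutes_inj[OF \<pi>] permutes_bij[OF \<pi>]
      by (simp add: keys_map_key bij_vimage_eq_inv_image)
    have "inv \<pi> ` Poly_Mapping.keys m \<subseteq> {1..n} \<longleftrightarrow> Poly_Mapping.keys m \<subseteq> {1..n}"
      using permutes_in_image[OF permutes_inv[OF \<pi>]] by auto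
    moreover have "card (inv \<pi> ` Poly_Mapping.keys m) = card (Poly_Mapping.keys m)"
      using permutes_inj[OF permutes_inv[OF \<pi>]] by (simp add: card_image inj_on_subset)
    moreover have "(\<forall>i. Poly_Mapping.lookup (Poly_Mapping.map_key \<pi> m) i \<le> 1)
        \<longleftrightarrow> (\<forall>i. Poly_Mapping.lookup m i \<le> 1)"
      using permutes_inj[OF \<pi>] permutes_surj[OF \<pi>] by (simp add: lookup_map_key) (metis surjD)
    ultimately show "Poly_Mapping.lookup p (Poly_Mapping.map_key \<pi> m) = Poly_Mapping.lookup p m"
      unfolding lp keys Q_def by simp
  qed
  moreover have "total_degree p \<le> k"
    unfolding total_degree_le_iff
  proof
    fix m assume "m \<in> Poly_Mapping.keys p"
    then have "Poly_Mapping.keys m \<in> Q" "\<And>i. Poly_Mapping.lookup m i \<le> 1"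
      unfolding in_keys_iff lp by (simp_all split: if_splits)
    then show "monom_degree m \<le> k"
      using sum_bounded_above[of "Poly_Mapping.keys m" "Poly_Mapping.lookup m" 1]
      by (simp add: monom_degree_def Q_def)
  qed
  moreover have "mpoly_eval x p = esym {1..n} k x" for x
  proof -
    have "monom_eval x (mon S) = (\<Prod>i\<in>S. x i)" if "S \<in> Q" for S
      using fin[OF that] by (simp add: monom_eval_def kmon lmon)
    then show ?thesis
      by (simp add: p_def mpoly_eval_sum mpoly_eval_single esym_def Q_def)
  qed
  ultimately show ?thesis by blast
qed

text \<open>Selection sort: put a minimal value in the last position and sort the rest.\<close>
lemma ex_permutes_antimono:
  fixes m :: "nat \<Rightarrow> nat"
  shows "\<exists>\<pi>. \<pi> permutes {1..n} \<and> (\<forall>i j. 1 \<le> i \<and> i \<le> j \<and> j \<le> n \<longrightarrow> m (\<pi> j) \<le> m (\<pi> i))"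
proof (induction n arbitrary: m)
  case 0
  then show ?case by (auto intro: exI[of _ id] permutes_id)
next
  case (Suc n)
  obtain p where p: "p \<in> {1..Suc n}" "\<And>i. i \<in> {1..Suc n} \<Longrightarrow> m p \<le> m i"
    using ex_min_if_finite[of "m ` {1..Suc n}"] by (fastforce simp: not_less)
  \<comment> \<open>Swapping \<open>p\<close> with the last position moves the minimum there.\<close>
  define t where "t = transpose p (Suc n)"
  have t: "t permutes {1..Suc n}"
    using p(1) unfolding t_def by (intro permutes_swap_id) auto
  obtain \<pi> where \<pi>: "\<pi> permutes {1..n}"
    "\<And>i j. 1 \<le> i \<and> i \<le> j \<and> j \<le> n \<Longrightarrow> m (t (\<pi> j)) \<le> m (t (\<pi> i))"
    using Suc.IH[of "m \<circ> t"] by auto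
  have \<pi>': "\<pi> permutes {1..Suc n}"
    by (rule permutes_subset[OF \<pi>(1)]) auto
  have "\<pi> (Suc n) = Suc n"
    using \<pi>(1) by (simp add: permutes_def)
  then have last: "t (\<pi> (Suc n)) = p"
    by (simp add: t_def)
  have "m ((t \<circ> \<pi>) j) \<le> m ((t \<circ> \<pi>) i)" if "1 \<le> i \<and> i \<le> j \<and> j \<le> Suc n" for i j
  proof (cases "j = Suc n")
    case True
    have "(t \<circ> \<pi>) i \<in> {1..Suc n}"
      using permutes_in_image[OF permutes_compose[OF \<pi>' t]] that by auto
    then show ?thesis using True last p(2) by simp
  qed (use that \<pi>(2) in auto)
  then show ?case
    using permutes_compose[OF \<pi>' t] by blast
qed

text \<open>Sorting the exponents of a monomial that occurs in \<open>p\<close> gives a partition with the same coefficient.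
  This is the upper bound on the dimension of the space of symmetric polynomials of degree at most
  \<open>d\<close>.\<close>
lemma sym_poly_eq_0I:
  assumes p: "p \<in> sym_polys n" and d: "total_degree p \<le> d"
    and z: "\<And>l. l \<in> partitions n \<Longrightarrow> psize n l \<le> d \<Longrightarrow>
      Poly_Mapping.lookup p (Poly_Mapping.Abs_poly_mapping l) = 0"
  shows "p = 0"
proof (rule ccontr)
  assume "p \<noteq> 0"
  then obtain m where m: "Poly_Mapping.lookup p m \<noteq> 0"
    by (metis lookup_zero poly_mapping_eqI)
  have keys: "Poly_Mapping.keys m \<subseteq> {1..n}"
    using sym_polys_keys[OF p m] .
  obtain \<pi> where \<pi>: "\<pi> permutes {1..n}"
    "\<And>i j. 1 \<le> i \<and> i \<le> j \<and> j \<le> n \<Longrightarrow> Poly_Mapping.lookup m (\<pi> j) \<le> Poly_Mapping.lookup m (\<pi> i)"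
    using ex_permutes_antimono by meson
  define l where "l = Poly_Mapping.lookup (Poly_Mapping.map_key \<pi> m)"
  have l: "l i = Poly_Mapping.lookup m (\<pi> i)" for i
    by (simp add: l_def lookup_map_key permutes_inj[OF \<pi>(1)])
  have "l i = 0" if "i \<notin> {1..n}" for i
  proof -
    have "i \<notin> Poly_Mapping.keys m"
      using keys that by blast
    then show ?thesis
      using permutes_not_in[OF \<pi>(1) that] by (simp add: l in_keys_iff)
  qed
  then have part: "l \<in> partitions n"
    using \<pi>(2) by (auto simp: partitions_def l)
  have "psize n l = (\<Sum>i=1..n. Poly_Mapping.lookup m i)"
    unfolding psize_def l using sum.permute[OF \<pi>(1), of "Poly_Mapping.lookup m"] by simp
  also have "\<dots> = monom_degree m"
    using monom_degree_superset[OF _ keys] by simp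
  also have "\<dots> \<le> d"
    using d m by (auto simp: total_degree_le_iff in_keys_iff)
  finally have "Poly_Mapping.lookup p (Poly_Mapping.Abs_poly_mapping l) = 0"
    using z part by blast
  then show False
    using m sym_polys_perm[OF p \<pi>(1)] by (simp add: l_def lookup_inverse)
qed

text \<open>Gaussian elimination: a pivot in the column \<open>q\<close> is used to clear that column, which leaves one
  vector and one coordinate less.\<close>
lemma ex_linear_relation:
  fixes v :: "'i \<Rightarrow> 'p \<Rightarrow> 'a::field"
  assumes "finite P" and "finite I" and "card P < card I"
  shows "\<exists>a. (\<exists>i\<in>I. a i \<noteq> 0) \<and> (\<forall>p\<in>P. (\<Sum>i\<in>I. a i * v i p) = 0)"
  using assms
proof (induction P arbitrary: I v rule: finite_induct)
  case empty
  then obtain i where "i \<in> I" by fastforce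
  then show ?case by (auto intro!: exI[of _ "\<lambda>_. 1"])
next
  case (insert q P)
  show ?case
  proof (cases "\<exists>i\<in>I. v i q \<noteq> 0")
    case False
    have "card P < card I"
      using insert by simp
    then obtain a where "\<exists>i\<in>I. a i \<noteq> 0" "\<forall>p\<in>P. (\<Sum>i\<in>I. a i * v i p) = 0"
      using insert.IH[OF insert.prems(1)] by blast
    with False show ?thesis by (intro exI[of _ a]) auto
  next
    case True
    then obtain j where j: "j \<in> I" "v j q \<noteq> 0" by blast
    define J where "J = I - {j}"
    have J: "finite J" "j \<notin> J" "I = insert j J"
      using insert.prems j by (auto simp: J_def)
    have "card P < card J"
      using insert J by simp
    then obtain a where a: "\<exists>i\<in>J. a i \<noteq> 0"
      "\<And>p. p \<in> P \<Longrightarrow> (\<Sum>i\<in>J. a i * (v i p - v i q / v j q * v j p)) = 0"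
      using insert.IH[OF J(1), of "\<lambda>i p. v i p - v i q / v j q * v j p"] by blast
    define s where "s = (\<Sum>i\<in>J. a i * (v i q / v j q))"
    define b where "b = a(j := - s)"
    have b: "(\<Sum>i\<in>I. b i * v i p) = (\<Sum>i\<in>J. a i * (v i p - v i q / v j q * v j p))" for p
    proof -
      have "(\<Sum>i\<in>I. b i * v i p) = b j * v j p + (\<Sum>i\<in>J. b i * v i p)"
        using J by simp
      also have "(\<Sum>i\<in>J. b i * v i p) = (\<Sum>i\<in>J. a i * v i p)"
        by (rule sum.cong) (use J in \<open>auto simp: b_def\<close>)
      finally show ?thesis
        by (simp add: b_def s_def right_diff_distrib sum_subtractf sum_distrib_right mult.assoc)
    qed
    have "\<exists>i\<in>I. b i \<noteq> 0"
      using a(1) J by (auto simp: b_def)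
    moreover have "\<forall>p\<in>insert q P. (\<Sum>i\<in>I. b i * v i p) = 0"
      using a(2) j(2) by (auto simp: b)
    ultimately show ?thesis by blast
  qed
qed

lemma esym_0 [simp]: "finite A \<Longrightarrow> esym A 0 x = 1"
proof -
  assume "finite A"
  then have "{S. S \<subseteq> A \<and> card S = 0} = {{}}"
    by (auto dest: finite_subset)
  then show ?thesis by (simp add: esym_def)
qed

lemma esym_eq_0: "finite A \<Longrightarrow> card A < k \<Longrightarrow> esym A k x = 0"
proof -
  assume A: "finite A" "card A < k"
  then have "{S. S \<subseteq> A \<and> card S = k} = {}"
    by (auto dest: card_mono[OF A(1)])
  then show ?thesis by (simp only: esym_def) simp
qed

lemma esym_cong: "(\<And>i. i \<in> A \<Longrightarrow> x i = y i) \<Longrightarrow> esym A k x = esym A k y"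
  unfolding esym_def by (intro sum.cong prod.cong) auto

lemma esym_insert:
  assumes "finite A" and "a \<notin> A"
  shows "esym (insert a A) (Suc k) x = esym A (Suc k) x + x a * esym A k x"
proof -
  let ?S = "\<lambda>k. {S. S \<subseteq> A \<and> card S = k}"
  have fin: "finite (?S k)" for k
    by (rule finite_subset[of _ "Pow A"]) (use assms in auto)
  have eq: "{S. S \<subseteq> insert a A \<and> card S = Suc k} = ?S (Suc k) \<union> insert a ` ?S k"
  proof (intro equalityI subsetI)
    fix S assume S: "S \<in> {S. S \<subseteq> insert a A \<and> card S = Suc k}"
    show "S \<in> ?S (Suc k) \<union> insert a ` ?S k"
    proof (cases "a \<in> S")
      case True
      then have "S = insert a (S - {a})" "S - {a} \<in> ?S k"
        using S by auto
      then show ?thesis by blast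
    qed (use S in auto)
  next
    fix S assume "S \<in> ?S (Suc k) \<union> insert a ` ?S k"
    then show "S \<in> {S. S \<subseteq> insert a A \<and> card S = Suc k}"
      using assms finite_subset[OF _ assms(1)] by (auto simp: card_insert_if subset_iff)
  qed
  have inj: "inj_on (insert a) (?S k)"
    using assms(2) by (intro inj_onI) auto
  have "esym (insert a A) (Suc k) x
      = (\<Sum>S\<in>?S (Suc k). \<Prod>i\<in>S. x i) + (\<Sum>S\<in>insert a ` ?S k. \<Prod>i\<in>S. x i)"
    unfolding esym_def eq by (rule sum.union_disjoint) (use fin assms(2) in auto)
  also have "(\<Sum>S\<in>insert a ` ?S k. \<Prod>i\<in>S. x i) = (\<Sum>S\<in>?S k. \<Prod>i\<in>insert a S. x i)"
    by (simp add: sum.reindex[OF inj])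
  also have "\<dots> = (\<Sum>S\<in>?S k. x a * (\<Prod>i\<in>S. x i))"
  proof (rule sum.cong)
    fix S assume "S \<in> ?S k"
    then have "finite S" "a \<notin> S"
      using assms finite_subset by auto
    then show "(\<Prod>i\<in>insert a S. x i) = x a * (\<Prod>i\<in>S. x i)"
      by simp
  qed simp
  finally show ?thesis
    by (simp add: esym_def sum_distrib_left)
qed

lemma esym_remove:
  fixes x :: "nat \<Rightarrow> 'a::comm_ring_1"
  assumes "finite A" and "a \<in> A"
  shows "esym (A - {a}) (Suc k) x = esym A (Suc k) x - x a * esym (A - {a}) k x"
  using esym_insert[of "A - {a}" a k x] assms by (simp add: insert_absorb)

lemma prod_diff_eq_esym:
  fixes x :: "nat \<Rightarrow> 'a::comm_ring_1"
  assumes "finite A"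
  shows "(\<Prod>i\<in>A. z - x i) = (\<Sum>k\<le>card A. (-1) ^ k * esym A k x * z ^ (card A - k))"
  using assms
proof (induction A rule: finite_induct)
  case (insert a A)
  let ?N = "card A"
  have shift: "(\<Sum>k\<le>Suc ?N. (-1) ^ k * esym A k x * z ^ (Suc ?N - k))
      = z ^ Suc ?N + (\<Sum>k\<le>?N. (-1) ^ Suc k * esym A (Suc k) x * z ^ (?N - k))"
    using insert(1) by (subst sum.atMost_Suc_shift) simp
  have "(\<Sum>k\<le>Suc ?N. (-1) ^ k * esym (insert a A) k x * z ^ (Suc ?N - k))
      = z ^ Suc ?N + (\<Sum>k\<le>?N. (-1) ^ Suc k * esym (insert a A) (Suc k) x * z ^ (?N - k))"
    using insert by (subst sum.atMost_Suc_shift) simp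
  also have "(\<Sum>k\<le>?N. (-1) ^ Suc k * esym (insert a A) (Suc k) x * z ^ (?N - k))
      = (\<Sum>k\<le>?N. (-1) ^ Suc k * esym A (Suc k) x * z ^ (?N - k))
        - x a * (\<Sum>k\<le>?N. (-1) ^ k * esym A k x * z ^ (?N - k))"
    unfolding sum_distrib_left sum_subtractf[symmetric]
    by (rule sum.cong) (simp_all add: esym_insert[OF insert(1,2)] algebra_simps)
  also have "z ^ Suc ?N + ((\<Sum>k\<le>?N. (-1) ^ Suc k * esym A (Suc k) x * z ^ (?N - k))
        - x a * (\<Sum>k\<le>?N. (-1) ^ k * esym A k x * z ^ (?N - k)))
      = (\<Sum>k\<le>Suc ?N. (-1) ^ k * esym A k x * z ^ (Suc ?N - k))
        - x a * (\<Sum>k\<le>?N. (-1) ^ k * esym A k x * z ^ (?N - k))"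
    unfolding shift by simp
  also have "(\<Sum>k\<le>Suc ?N. (-1) ^ k * esym A k x * z ^ (Suc ?N - k))
      = z * (\<Sum>k\<le>?N. (-1) ^ k * esym A k x * z ^ (?N - k))"
    using insert(1) by (simp add: esym_eq_0 sum_distrib_left Suc_diff_le algebra_simps)
  finally show ?case
    using insert by (simp add: algebra_simps)
qed simp

section \<open>The filtered algebra of symmetric polynomial functions\<close>

text \<open>\<open>sym_fun n d f\<close> means that the function \<open>f\<close> is a polynomial in \<open>e\<^sub>1, \<dots>, e\<^sub>n\<close> of weighted degree at
  most \<open>d\<close>, where \<open>e\<^sub>k\<close> has weight \<open>k\<close>. Working with functions generated in this way, and not with
  formal polynomials, makes closure properties of difference operators provable by induction on
  the generation.\<close>
inductive sym_fun :: "nat \<Rightarrow> nat \<Rightarrow> ((nat \<Rightarrow> 'a) \<Rightarrow> 'a::field) \<Rightarrow> bool" for n where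
  const: "sym_fun n 0 (\<lambda>x. c)"
| esym: "sym_fun n k (esym {1..n} k)"
| add: "sym_fun n d f \<Longrightarrow> sym_fun n d g \<Longrightarrow> sym_fun n d (\<lambda>x. f x + g x)"
| mult: "sym_fun n a f \<Longrightarrow> sym_fun n b g \<Longrightarrow> sym_fun n (a + b) (\<lambda>x. f x * g x)"
| mono: "sym_fun n a f \<Longrightarrow> a \<le> b \<Longrightarrow> sym_fun n b f"

lemma sym_fun_const: "sym_fun n d (\<lambda>x. c)"
  using sym_fun.mono[OF sym_fun.const] by blast

lemma sym_fun_cmult: "sym_fun n d f \<Longrightarrow> sym_fun n d (\<lambda>x. c * f x)"
  using sym_fun.mult[OF sym_fun.const, of n d f c] by simp

lemma sym_fun_diff: "sym_fun n d f \<Longrightarrow> sym_fun n d g \<Longrightarrow> sym_fun n d (\<lambda>x. f x - g x)"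
  using sym_fun.add[OF _ sym_fun_cmult[of n d g "-1"], of f] by simp

lemma sym_fun_sum:
  "(\<And>i. i \<in> I \<Longrightarrow> sym_fun n d (f i)) \<Longrightarrow> sym_fun n d (\<lambda>x. \<Sum>i\<in>I. f i x)"
  by (induction I rule: infinite_finite_induct) (auto intro: sym_fun_const sym_fun.add)

lemma sym_fun_prod:
  "(\<And>i. i \<in> I \<Longrightarrow> sym_fun n (d i) (f i)) \<Longrightarrow> sym_fun n (\<Sum>i\<in>I. d i) (\<lambda>x. \<Prod>i\<in>I. f i x)"
  by (induction I rule: infinite_finite_induct) (auto intro: sym_fun_const sym_fun.mult)

lemma sym_fun_imp_mpoly:
  "sym_fun n d f \<Longrightarrow> \<exists>p\<in>sym_polys n. total_degree p \<le> d \<and> (\<forall>x. mpoly_eval x p = f x)"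
proof (induction rule: sym_fun.induct)
  case (const c)
  have "total_degree (Poly_Mapping.single 0 c :: 'a mpoly) \<le> 0"
    unfolding total_degree_le_iff by (auto simp: monom_degree_def)
  then show ?case
    using sym_polys_single_0[of c] by (auto simp: mpoly_eval_single)
next
  case (esym k)
  show ?case by (rule ex_sym_poly_esym)
next
  case (add d f g)
  then show ?case
    by (metis sym_polys_add total_degree_add_le mpoly_eval_add)
next
  case (mult a f b g)
  then show ?case
    by (metis sym_polys_mult total_degree_mult_le mpoly_eval_mult)
next
  case (mono a f b)
  then show ?case by (meson order_trans)
qed

text \<open>Symmetric functions with one distinguished variable: sums of \<open>f(x) z\<^sup>k\<close> of total degree at most \<open>d\<close>,
  where \<open>f\<close> is symmetric. They will be evaluated at \<open>z = x\<^sub>i\<close>.\<close>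
inductive mixed_fun :: "nat \<Rightarrow> nat \<Rightarrow> ((nat \<Rightarrow> 'a) \<Rightarrow> 'a \<Rightarrow> 'a::field) \<Rightarrow> bool" for n d where
  monom: "sym_fun n a f \<Longrightarrow> a + k \<le> d \<Longrightarrow> mixed_fun n d (\<lambda>x z. f x * z ^ k)"
| add: "mixed_fun n d p \<Longrightarrow> mixed_fun n d q \<Longrightarrow> mixed_fun n d (\<lambda>x z. p x z + q x z)"

lemma mixed_fun_sym: "sym_fun n d f \<Longrightarrow> mixed_fun n d (\<lambda>x z. f x)"
  using mixed_fun.monom[of n d f 0 d] by simp

lemma mixed_fun_power: "k \<le> d \<Longrightarrow> mixed_fun n d (\<lambda>x z. z ^ k)"
  using mixed_fun.monom[OF sym_fun.const[of n 1], of k d] by simp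

lemma mixed_fun_mono: "mixed_fun n a p \<Longrightarrow> a \<le> b \<Longrightarrow> mixed_fun n b p"
  by (induction rule: mixed_fun.induct) (auto intro: mixed_fun.intros)

lemma mixed_fun_mult:
  assumes "mixed_fun n a p" and "mixed_fun n b q"
  shows "mixed_fun n (a + b) (\<lambda>x z. p x z * q x z)"
  using assms
proof (induction rule: mixed_fun.induct)
  case (monom a1 f k)
  from monom(3) show ?case
  proof (induction rule: mixed_fun.induct)
    case (monom b1 g l)
    have "mixed_fun n (a + b) (\<lambda>x z. (f x * g x) * z ^ (k + l))"
      using \<open>a1 + k \<le> a\<close> monom
      by (intro mixed_fun.monom[of n "a1 + b1"] sym_fun.mult \<open>sym_fun n a1 f\<close>) auto
    then show ?case by (simp add: power_add mult_ac)
  next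
    case (add p q)
    then show ?case
      using mixed_fun.add[of n "a + b" "\<lambda>x z. f x * z ^ k * p x z" "\<lambda>x z. f x * z ^ k * q x z"]
      by (simp add: algebra_simps)
  qed
next
  case (add p1 p2)
  then show ?case
    using mixed_fun.add[of n "a + b" "\<lambda>x z. p1 x z * q x z" "\<lambda>x z. p2 x z * q x z"]
    by (simp add: algebra_simps)
qed

lemma mixed_fun_cmult: "mixed_fun n d p \<Longrightarrow> mixed_fun n d (\<lambda>x z. c * p x z)"
  using mixed_fun_mult[OF mixed_fun_sym[OF sym_fun.const], of n d p c] by simp

lemma mixed_fun_diff:
  "mixed_fun n d p \<Longrightarrow> mixed_fun n d q \<Longrightarrow> mixed_fun n d (\<lambda>x z. p x z - q x z)"
  using mixed_fun.add[OF _ mixed_fun_cmult[of n d q "-1"], of p] by simp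

lemma mixed_fun_sum:
  "(\<And>i. i \<in> I \<Longrightarrow> mixed_fun n d (p i)) \<Longrightarrow> mixed_fun n d (\<lambda>x z. \<Sum>i\<in>I. p i x z)"
  by (induction I rule: infinite_finite_induct)
    (auto intro: mixed_fun.add mixed_fun_sym[OF sym_fun_const])

text \<open>Removing \<open>x\<^sub>i\<close> from the list of variables: \<open>e\<^sub>k(x without x\<^sub>i) = e\<^sub>k(x) - x\<^sub>i e\<^bsub>k-1\<^esub>(x without x\<^sub>i)\<close>, so
  the result depends polynomially on \<open>x\<^sub>i\<close> in the same way for all \<open>i\<close>.\<close>
lemma esym_remove_mixed:
  "\<exists>p. mixed_fun n k p \<and>
    (\<forall>x::nat \<Rightarrow> 'a::field. \<forall>i\<in>{1..n}. esym ({1..n} - {i}) k x = p x (x i))"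
proof (induction k)
  case 0
  show ?case
    by (intro exI[of _ "\<lambda>x z. 1"]) (auto intro: mixed_fun_sym sym_fun_const)
next
  case (Suc k)
  then obtain p where p: "mixed_fun n k p"
    "\<And>(x::nat \<Rightarrow> 'a) i. i \<in> {1..n} \<Longrightarrow> esym ({1..n} - {i}) k x = p x (x i)"
    by blast
  have "mixed_fun n (Suc k) (\<lambda>x z. esym {1..n} (Suc k) x - z * p x z)"
    using mixed_fun_mult[OF mixed_fun_power[of 1 1] p(1)]
    by (intro mixed_fun_diff mixed_fun_sym sym_fun.esym) simp
  moreover have "esym ({1..n} - {i}) (Suc k) x = esym {1..n} (Suc k) x - x i * p x (x i)"
    if "i \<in> {1..n}" for x :: "nat \<Rightarrow> 'a" and i
    using esym_remove[OF _ that, of k x] p(2)[OF that, of x] by simp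
  ultimately show ?case
    by blast
qed

text \<open>The difference \<open>f(x) - f(x - e\<^sub>i)\<close> has degree at most \<open>d - 1\<close>. This gain is recorded after
  multiplication by \<open>x\<^sub>i\<close>, which avoids a truncated subtraction and is the form in which
  the difference occurs in the lowering operator. The bound on the shifted function itself is carried
  along for the product rule.\<close>
lemma sym_fun_shift:
  fixes f :: "(nat \<Rightarrow> 'a::field) \<Rightarrow> 'a"
  assumes "sym_fun n d f"
  shows "\<exists>s r. mixed_fun n d s \<and> mixed_fun n d r \<and> (\<forall>x. \<forall>i\<in>{1..n}.
    f (x(i := x i - 1)) = s x (x i) \<and> x i * (f x - f (x(i := x i - 1))) = r x (x i))"
  using assms
proof (induction rule: sym_fun.induct)
  case (const c)
  show ?case
    by (intro exI[of _ "\<lambda>x z. c"] exI[of _ "\<lambda>x z. 0"])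
      (auto intro: mixed_fun_sym sym_fun_const)
next
  case (esym k)
  show ?case
  proof (cases k)
    case 0
    then show ?thesis
      by (intro exI[of _ "\<lambda>x z. 1"] exI[of _ "\<lambda>x z. 0"])
        (auto intro: mixed_fun_sym sym_fun_const)
  next
    case (Suc l)
    obtain p where p: "mixed_fun n l p"
      "\<And>(x::nat \<Rightarrow> 'a) i. i \<in> {1..n} \<Longrightarrow> esym ({1..n} - {i}) l x = p x (x i)"
      using esym_remove_mixed by metis
    have shift: "esym {1..n} k (x(i := x i - 1)) = esym {1..n} k x - p x (x i)"
      if i: "i \<in> {1..n}" for x :: "nat \<Rightarrow> 'a" and i
    proof -
      let ?y = "x(i := x i - 1)"
      have eq: "esym ({1..n} - {i}) m ?y = esym ({1..n} - {i}) m x" for m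
        by (rule esym_cong) auto
      have "esym {1..n} k ?y = esym ({1..n} - {i}) k x + (x i - 1) * esym ({1..n} - {i}) l x"
        using esym_remove[of "{1..n}" i l ?y] i by (simp add: Suc eq del: One_nat_def)
      also have "\<dots> = esym {1..n} k x - p x (x i)"
        using esym_remove[of "{1..n}" i l x] i p(2)[OF i, of x]
        by (simp add: Suc algebra_simps del: One_nat_def)
      finally show ?thesis .
    qed
    have "mixed_fun n k (\<lambda>x z. esym {1..n} k x - p x z)"
      using mixed_fun_mono[OF p(1), of k] Suc
      by (intro mixed_fun_diff mixed_fun_sym sym_fun.esym) simp
    moreover have "mixed_fun n k (\<lambda>x z. z * p x z)"
      using mixed_fun_mult[OF mixed_fun_power[of 1 1] p(1)] Suc by simp
    moreover have "x i * (esym {1..n} k x - esym {1..n} k (x(i := x i - 1))) = x i * p x (x i)"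
      if "i \<in> {1..n}" for x :: "nat \<Rightarrow> 'a" and i
      unfolding shift[OF that] by simp
    ultimately show ?thesis
      using shift by blast
  qed
next
  case (add d f g)
  then obtain s1 r1 s2 r2 where IH:
    "mixed_fun n d s1" "mixed_fun n d r1" "mixed_fun n d s2" "mixed_fun n d r2"
    "\<And>(x::nat \<Rightarrow> 'a) i. i \<in> {1..n} \<Longrightarrow> f (x(i := x i - 1)) = s1 x (x i)"
    "\<And>(x::nat \<Rightarrow> 'a) i. i \<in> {1..n} \<Longrightarrow> x i * (f x - f (x(i := x i - 1))) = r1 x (x i)"
    "\<And>(x::nat \<Rightarrow> 'a) i. i \<in> {1..n} \<Longrightarrow> g (x(i := x i - 1)) = s2 x (x i)"
    "\<And>(x::nat \<Rightarrow> 'a) i. i \<in> {1..n} \<Longrightarrow> x i * (g x - g (x(i := x i - 1))) = r2 x (x i)"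
    by metis
  show ?case
  proof (intro exI conjI allI ballI)
    show "mixed_fun n d (\<lambda>x z. s1 x z + s2 x z)" "mixed_fun n d (\<lambda>x z. r1 x z + r2 x z)"
      by (intro mixed_fun.add IH)+
    fix x :: "nat \<Rightarrow> 'a" and i assume i: "i \<in> {1..n}"
    show "f (x(i := x i - 1)) + g (x(i := x i - 1)) = s1 x (x i) + s2 x (x i)"
      using IH i by simp
    show "x i * (f x + g x - (f (x(i := x i - 1)) + g (x(i := x i - 1)))) = r1 x (x i) + r2 x (x i)"
      unfolding IH(6)[OF i, symmetric] IH(8)[OF i, symmetric] by (simp add: algebra_simps)
  qed
next
  case (mult a f b g)
  then obtain s1 r1 s2 r2 where IH:
    "mixed_fun n a s1" "mixed_fun n a r1" "mixed_fun n b s2" "mixed_fun n b r2"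
    "\<And>(x::nat \<Rightarrow> 'a) i. i \<in> {1..n} \<Longrightarrow> f (x(i := x i - 1)) = s1 x (x i)"
    "\<And>(x::nat \<Rightarrow> 'a) i. i \<in> {1..n} \<Longrightarrow> x i * (f x - f (x(i := x i - 1))) = r1 x (x i)"
    "\<And>(x::nat \<Rightarrow> 'a) i. i \<in> {1..n} \<Longrightarrow> g (x(i := x i - 1)) = s2 x (x i)"
    "\<And>(x::nat \<Rightarrow> 'a) i. i \<in> {1..n} \<Longrightarrow> x i * (g x - g (x(i := x i - 1))) = r2 x (x i)"
    by metis
  show ?case
  proof (intro exI conjI allI ballI)
    show "mixed_fun n (a + b) (\<lambda>x z. s1 x z * s2 x z)"
      "mixed_fun n (a + b) (\<lambda>x z. r1 x z * g x + s1 x z * r2 x z)"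
      by (intro mixed_fun.add mixed_fun_mult mixed_fun_sym IH mult.hyps)+
    fix x :: "nat \<Rightarrow> 'a" and i assume i: "i \<in> {1..n}"
    show "f (x(i := x i - 1)) * g (x(i := x i - 1)) = s1 x (x i) * s2 x (x i)"
      using IH i by simp
    show "x i * (f x * g x - f (x(i := x i - 1)) * g (x(i := x i - 1)))
        = r1 x (x i) * g x + s1 x (x i) * r2 x (x i)"
      unfolding IH(5)[OF i, symmetric] IH(6)[OF i, symmetric] IH(8)[OF i, symmetric]
      by (simp add: algebra_simps)
  qed
next
  case (mono a f b)
  then show ?case by (meson mixed_fun_mono)
qed

section \<open>The lowering operator\<close>

text \<open>The sum is the coefficient of \<open>z\<^bsup>card A - 1\<^esup>\<close> in the polynomial of degree less than
  \<open>card A\<close> that interpolates \<open>z\<^sup>j\<close> at the points \<open>x\<^sub>i\<close>; for \<open>j < card A\<close> this polynomial is \<open>z\<^sup>j\<close> itself.\<close>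
lemma lagrange_power_sum:
  fixes x :: "nat \<Rightarrow> 'a::field"
  assumes "finite A" and "inj_on x A" and "j < card A"
  shows "(\<Sum>i\<in>A. x i ^ j / (\<Prod>l\<in>A - {i}. x i - x l)) = (if Suc j = card A then 1 else 0)"
proof -
  define q where "q i = (\<Prod>l\<in>A - {i}. [:- x l, 1:])" for i
  define D where "D i = (\<Prod>l\<in>A - {i}. x i - x l)" for i
  define L where "L = (\<Sum>i\<in>A. smult (x i ^ j / D i) (q i))"
  have D: "D i \<noteq> 0" if "i \<in> A" for i
    using assms that by (auto simp: D_def inj_on_def)
  have deg: "degree (q i) = card A - 1" if "i \<in> A" for i
    using that assms(1) unfolding q_def by (subst degree_prod_eq_sum_degree) auto
  have lead: "lead_coeff (q i) = 1" for i
    by (simp add: q_def lead_coeff_prod)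
  have eval: "poly (q i) (x m) = (if m = i then D i else 0)" if "m \<in> A" for i m
    using that assms(1) by (auto simp: q_def D_def poly_prod)
  have "L = monom 1 j"
  proof (rule poly_eqI_degree[where A = "x ` A"])
    fix y assume "y \<in> x ` A"
    then obtain m where m: "m \<in> A" "y = x m" by blast
    have "poly L y = (\<Sum>i\<in>A. if m = i then x i ^ j / D i * D i else 0)"
      unfolding L_def m(2) poly_sum using m(1) by (intro sum.cong) (auto simp: eval)
    also have "\<dots> = x m ^ j"
      using assms(1) m(1) D by simp
    finally show "poly L y = poly (monom 1 j) y"
      by (simp add: m poly_monom)
  next
    have card: "card (x ` A) = card A"
      using assms(2) by (rule card_image)
    have "degree L \<le> card A - 1"
      unfolding L_def using deg by (intro degree_sum_le assms(1)) (metis degree_smult_le)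
    then show "degree L < card (x ` A)"
      using assms(3) card by linarith
    show "degree (monom (1::'a) j) < card (x ` A)"
      using assms(3) card by (simp add: degree_monom_eq)
  qed
  then have "coeff L (card A - 1) = coeff (monom 1 j) (card A - 1)" by simp
  moreover have "coeff L (card A - 1) = (\<Sum>i\<in>A. x i ^ j / D i)"
    unfolding L_def coeff_sum coeff_smult
  proof (rule sum.cong)
    fix i assume "i \<in> A"
    then show "x i ^ j / D i * coeff (q i) (card A - 1) = x i ^ j / D i"
      using lead[of i] deg[of i] by simp
  qed simp
  ultimately have "(\<Sum>i\<in>A. x i ^ j / D i) = (if j = card A - 1 then 1 else 0)"
    by simp
  moreover have "j = card A - 1 \<longleftrightarrow> Suc j = card A"
    using assms(3) by auto
  ultimately show ?thesis
    by (simp add: D_def)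
qed

text \<open>These sums are the complete homogeneous functions of degree \<open>j + 1 - n\<close>. Since each \<open>x\<^sub>i\<close> is a root of
  \<open>\<Prod>\<^sub>l (z - x\<^sub>l)\<close>, the powers \<open>x\<^sub>i\<^sup>j\<close>, hence also the sums, satisfy a linear recurrence of order \<open>n\<close>
  with coefficients \<open>\<plusminus>e\<^sub>k\<close>. The first \<open>n\<close> values come from Lagrange interpolation. As
  \<open>Suc j - n\<close> is truncated, the vanishing for \<open>Suc j < n\<close> is stated separately; the degree count in
  the recurrence depends on it.\<close>
lemma divided_power_sum_sym_fun:
  assumes "n \<ge> 1"
  shows "\<exists>f. sym_fun n (Suc j - n) f \<and> (Suc j < n \<longrightarrow> f = (\<lambda>_. 0)) \<and>
    (\<forall>x::nat \<Rightarrow> 'a::field. inj_on x {1..n} \<longrightarrow>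
      (\<Sum>i=1..n. x i ^ j / (\<Prod>l\<in>{1..n} - {i}. x i - x l)) = f x)"
proof (induction j rule: less_induct)
  case (less j)
  show ?case
  proof (cases "j < n")
    case True
    then show ?thesis
      using lagrange_power_sum[of "{1..n}" _ j]
      by (intro exI[of _ "\<lambda>_. if Suc j = n then 1 else 0"]) (auto intro: sym_fun_const)
  next
    case False
    let ?D = "\<lambda>(x::nat \<Rightarrow> 'a) i. \<Prod>l\<in>{1..n} - {i}. x i - x l"
    define R where "R m f \<longleftrightarrow> sym_fun n (Suc m - n) f \<and> (Suc m < n \<longrightarrow> f = (\<lambda>_. 0)) \<and>
      (\<forall>x. inj_on x {1..n} \<longrightarrow> (\<Sum>i=1..n. x i ^ m / ?D x i) = f x)" for m f
    have "\<forall>m\<in>{..<j}. \<exists>f. R m f"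
      using less.IH unfolding R_def by blast
    then obtain F where "\<forall>m\<in>{..<j}. R m (F m)"
      by (rule bchoice[THEN exE])
    then have F: "\<And>m. m < j \<Longrightarrow> sym_fun n (Suc m - n) (F m)"
      "\<And>m. m < j \<Longrightarrow> Suc m < n \<Longrightarrow> F m = (\<lambda>_. 0)"
      "\<And>m x. m < j \<Longrightarrow> inj_on x {1..n} \<Longrightarrow> (\<Sum>i=1..n. x i ^ m / ?D x i) = F m x"
      unfolding R_def by blast+
    define f where "f x = (\<Sum>k=1..n. (- ((-1) ^ k)) * (esym {1..n} k x * F (j - k) x))"
      for x :: "nat \<Rightarrow> 'a"
    have "sym_fun n (Suc j - n) (\<lambda>x. esym {1..n} k x * F (j - k) x)" if k: "k \<in> {1..n}" for k
    proof (cases "Suc (j - k) < n")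
      case True
      then have "F (j - k) = (\<lambda>_. 0)"
        using F(2) k False by auto
      then show ?thesis by (simp add: sym_fun_const)
    next
      case Fk: False
      have "sym_fun n (k + (Suc (j - k) - n)) (\<lambda>x. esym {1..n} k x * F (j - k) x)"
        by (intro sym_fun.mult sym_fun.esym F(1)) (use k False in auto)
      moreover have "k + (Suc (j - k) - n) = Suc j - n"
        using Fk k False by auto
      ultimately show ?thesis by argo
    qed
    then have "sym_fun n (Suc j - n) f"
      unfolding f_def by (intro sym_fun_sum sym_fun_cmult)
    moreover have "(\<Sum>i=1..n. x i ^ j / ?D x i) = f x" if inj: "inj_on x {1..n}" for x :: "nat \<Rightarrow> 'a"
    proof -
      have pow: "x i ^ j = (\<Sum>k=1..n. (- ((-1) ^ k)) * (esym {1..n} k x * x i ^ (j - k)))"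
        if i: "i \<in> {1..n}" for i
      proof -
        have "0 = (\<Prod>l\<in>{1..n}. x i - x l)"
          using i by (intro prod_zero[symmetric]) auto
        also have "\<dots> = (\<Sum>k\<le>n. (-1) ^ k * esym {1..n} k x * x i ^ (n - k))"
          by (subst prod_diff_eq_esym) auto
        finally have "0 = x i ^ (j - n) * (\<Sum>k\<le>n. (-1) ^ k * esym {1..n} k x * x i ^ (n - k))"
          by simp
        also have "\<dots> = (\<Sum>k\<le>n. (-1) ^ k * (esym {1..n} k x * x i ^ (j - k)))"
          unfolding sum_distrib_left
        proof (rule sum.cong)
          fix k assume "k \<in> {..n}"
          then have "j - k = (j - n) + (n - k)"
            using False by auto
          then show "x i ^ (j - n) * ((-1) ^ k * esym {1..n} k x * x i ^ (n - k))
              = (-1) ^ k * (esym {1..n} k x * x i ^ (j - k))"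
            by (simp add: power_add)
        qed simp
        also have "{..n} = insert 0 {1..n}" by auto
        also have "(\<Sum>k\<in>insert 0 {1..n}. (-1) ^ k * (esym {1..n} k x * x i ^ (j - k)))
            = x i ^ j + (\<Sum>k=1..n. (-1) ^ k * (esym {1..n} k x * x i ^ (j - k)))"
          by (subst sum.insert) auto
        finally show ?thesis
          by (simp add: sum_negf eq_neg_iff_add_eq_0)
      qed
      have "(\<Sum>i=1..n. x i ^ j / ?D x i) = (\<Sum>i=1..n. \<Sum>k=1..n.
          (- ((-1) ^ k)) * (esym {1..n} k x * (x i ^ (j - k) / ?D x i)))"
        by (intro sum.cong refl, subst pow) (simp_all add: sum_divide_distrib)
      also have "\<dots> = (\<Sum>k=1..n. (- ((-1) ^ k)) * (esym {1..n} k x * (\<Sum>i=1..n. x i ^ (j - k) / ?D x i)))"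
        by (subst sum.swap) (simp add: sum_distrib_left)
      also have "\<dots> = f x"
        unfolding f_def by (intro sum.cong refl) (use F(3)[OF _ inj] False assms in auto)
      finally show ?thesis .
    qed
    ultimately show ?thesis
      using False by (intro exI[of _ f]) auto
  qed
qed

lemma mixed_fun_divided_sum:
  fixes p :: "(nat \<Rightarrow> 'a::field) \<Rightarrow> 'a \<Rightarrow> 'a"
  assumes "n \<ge> 1" and "mixed_fun n d p"
  shows "\<exists>f. sym_fun n (Suc d - n) f \<and> (\<forall>x. inj_on x {1..n} \<longrightarrow>
    (\<Sum>i=1..n. p x (x i) / (\<Prod>l\<in>{1..n} - {i}. x i - x l)) = f x)"
  using assms(2)
proof (induction rule: mixed_fun.induct)
  case (monom a f k)
  obtain g where g: "sym_fun n (Suc k - n) g" "Suc k < n \<Longrightarrow> g = (\<lambda>_. 0)"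
    "\<And>x::nat \<Rightarrow> 'a. inj_on x {1..n} \<Longrightarrow> (\<Sum>i=1..n. x i ^ k / (\<Prod>l\<in>{1..n} - {i}. x i - x l)) = g x"
    using divided_power_sum_sym_fun[OF assms(1), where ?'a = 'a, of k] by blast
  have "sym_fun n (Suc d - n) (\<lambda>x. f x * g x)"
  proof (cases "Suc k < n")
    case True
    then show ?thesis using g(2) by (simp add: sym_fun_const)
  next
    case False
    then show ?thesis
      by (intro sym_fun.mono[OF sym_fun.mult[OF monom(1) g(1)]]) (use monom in auto)
  qed
  then show ?case
    using g(3) by (intro exI[of _ "\<lambda>x. f x * g x"]) (simp flip: sum_distrib_left times_divide_eq_right)
next
  case (add p q)
  then obtain f g where "sym_fun n (Suc d - n) f" "sym_fun n (Suc d - n) g"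
    "\<And>x. inj_on x {1..n} \<Longrightarrow> (\<Sum>i=1..n. p x (x i) / (\<Prod>l\<in>{1..n} - {i}. x i - x l)) = f x"
    "\<And>x. inj_on x {1..n} \<Longrightarrow> (\<Sum>i=1..n. q x (x i) / (\<Prod>l\<in>{1..n} - {i}. x i - x l)) = g x"
    by blast
  then show ?case
    by (intro exI[of _ "\<lambda>x. f x + g x"]) (auto simp: add_divide_distrib sum.distrib intro: sym_fun.add)
qed

text \<open>The factor for \<open>j\<close> in this product vanishes when \<open>x\<^sub>i - x\<^sub>j = t\<close>, which is what happens at a shifted
  partition for two equal adjacent rows.\<close>
definition lower_weight :: "'a::field \<Rightarrow> nat \<Rightarrow> nat \<Rightarrow> (nat \<Rightarrow> 'a) \<Rightarrow> 'a" where
  "lower_weight t n i x = x i * (\<Prod>j\<in>{1..n} - {i}. (x i - x j - t) / (x i - x j))"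

lemma mixed_fun_power_diff: "mixed_fun n (m - 1) (\<lambda>x z. (z - t) ^ m - z ^ m)"
proof (induction m)
  case 0
  show ?case using mixed_fun_sym[OF sym_fun_const[of n 0 0]] by simp
next
  case (Suc m)
  have lin: "mixed_fun n k (\<lambda>x z. (z - t) ^ k)" for k
  proof (induction k)
    case 0
    show ?case using mixed_fun_power[of 0 0 n] by simp
  next
    case (Suc k)
    have "mixed_fun n 1 (\<lambda>x z. z - t)"
      using mixed_fun_diff[OF mixed_fun_power[of 1 1 n] mixed_fun_sym[OF sym_fun_const[of n 1 t]]]
      by simp
    from mixed_fun_mult[OF this Suc] show ?case by simp
  qed
  have "mixed_fun n m (\<lambda>x z. z * ((z - t) ^ m - z ^ m))"
  proof (cases m)
    case 0
    then show ?thesis using mixed_fun_sym[OF sym_fun_const[of n 0 0]] by simp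
  next
    case (Suc l)
    then show ?thesis
      using mixed_fun_mult[OF mixed_fun_power[of 1 1 n] Suc.IH] by simp
  qed
  from mixed_fun_diff[OF this mixed_fun_cmult[OF lin[of m], of t]]
  show ?case by (simp add: algebra_simps)
qed

text \<open>Let \<open>P(z) = \<Prod>\<^sub>l (z - x\<^sub>l)\<close>. Because of \<open>P(x\<^sub>i) = 0\<close>, the numerator of the weight is
  \<open>x\<^sub>i (P(x\<^sub>i - t) - P(x\<^sub>i)) / (-t)\<close>, and the polynomial \<open>P(z - t) - P(z)\<close> has total degree only \<open>n - 1\<close>.
  So the summands are values at \<open>z = x\<^sub>i\<close> of a function of total degree \<open>d + n - 1\<close>, and dividing by
  \<open>\<Prod>\<^sub>l (x\<^sub>i - x\<^sub>l)\<close> and summing lowers the degree by \<open>n - 1\<close>.\<close>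
lemma sym_fun_lowering:
  fixes f :: "(nat \<Rightarrow> 'a::field) \<Rightarrow> 'a"
  assumes "n \<ge> 1" and "t \<noteq> 0" and "sym_fun n d f"
  shows "\<exists>g. sym_fun n d g \<and> (\<forall>x. inj_on x {1..n} \<longrightarrow>
    (\<Sum>i=1..n. lower_weight t n i x * (f x - f (x(i := x i - 1)))) = g x)"
proof -
  \<comment> \<open>\<open>q x z\<close> is \<open>P(z - t) - P(z)\<close>, expanded with the elementary symmetric functions as coefficients.\<close>
  define q where "q x z = (\<Sum>k\<le>n. ((-1) ^ k * esym {1..n} k x) * ((z - t) ^ (n - k) - z ^ (n - k)))"
    for x and z :: 'a
  have q: "mixed_fun n (n - 1) q"
    unfolding q_def
  proof (rule mixed_fun_sum)
    fix k assume "k \<in> {..n}"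
    then have k: "k = n \<or> k + (n - k - 1) = n - 1" by auto
    show "mixed_fun n (n - 1) (\<lambda>x z. ((-1) ^ k * esym {1..n} k x) * ((z - t) ^ (n - k) - z ^ (n - k)))"
    proof (cases "k = n")
      case True
      then show ?thesis by (simp add: mixed_fun_sym sym_fun_const)
    next
      case False
      then show ?thesis
        using mixed_fun_mult[OF mixed_fun_sym[OF sym_fun_cmult[OF sym_fun.esym[of n k], of "(-1) ^ k"]]
            mixed_fun_power_diff[of n "n - k" t]] k by simp
    qed
  qed
  have q_eq: "q x (x i) = - t * (\<Prod>j\<in>{1..n} - {i}. x i - x j - t)" if i: "i \<in> {1..n}" for x i
  proof -
    have "q x (x i) = (\<Prod>j\<in>{1..n}. x i - t - x j) - (\<Prod>j\<in>{1..n}. x i - x j)"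
      by (simp add: q_def prod_diff_eq_esym right_diff_distrib sum_subtractf)
    also have "(\<Prod>j\<in>{1..n}. x i - x j) = 0"
      using i by (intro prod_zero) auto
    also have "(\<Prod>j\<in>{1..n}. x i - t - x j) = - t * (\<Prod>j\<in>{1..n} - {i}. x i - t - x j)"
      using i by (subst prod.remove[of _ i]) auto
    finally show ?thesis by (simp add: algebra_simps)
  qed
  obtain r where r: "mixed_fun n d r"
    "\<And>x i. i \<in> {1..n} \<Longrightarrow> x i * (f x - f (x(i := x i - 1))) = r x (x i)"
    using sym_fun_shift[OF assms(3)] by metis
  have prod: "mixed_fun n (d + (n - 1)) (\<lambda>x z. (- 1 / t) * (r x z * q x z))"
    by (intro mixed_fun_cmult mixed_fun_mult r q)
  have deg: "Suc (d + (n - 1)) - n = d"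
    using assms(1) by simp
  obtain g where g: "sym_fun n d g"
    "\<And>x. inj_on x {1..n} \<Longrightarrow>
      (\<Sum>i=1..n. (- 1 / t) * (r x (x i) * q x (x i)) / (\<Prod>l\<in>{1..n} - {i}. x i - x l)) = g x"
    using mixed_fun_divided_sum[OF assms(1) prod] unfolding deg by blast
  have "lower_weight t n i x * (f x - f (x(i := x i - 1)))
      = (- 1 / t) * (r x (x i) * q x (x i)) / (\<Prod>l\<in>{1..n} - {i}. x i - x l)"
    if i: "i \<in> {1..n}" for x i
    unfolding q_eq[OF i] r(2)[OF i, symmetric] lower_weight_def prod_dividef
    using assms(2) by simp
  then show ?thesis
    using g by (intro exI[of _ g]) simp
qed

section \<open>Symmetric functions with prescribed last variables\<close>

text \<open>On the affine space where the variables after \<open>x\<^sub>r\<close> are fixed, symmetric functions of \<open>x\<^sub>1, \<dots>, x\<^sub>r\<close>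
  extend to symmetric functions of all the variables without an increase of the degree. This will
  supply factors that vanish where one row has a given length.\<close>
lemma esym_initial_sym_fun:
  fixes y :: "nat \<Rightarrow> 'a::field"
  assumes "r \<le> n"
  shows "\<exists>g. sym_fun n k g \<and> (\<forall>x. (\<forall>i\<in>{r<..n}. x i = y i) \<longrightarrow> g x = esym {1..r} k x)"
  using assms
proof (induction r arbitrary: k rule: inc_induct)
  case base
  show ?case
    using sym_fun.esym by auto
next
  case (step r)
  show ?case
  proof (induction k)
    case 0
    show ?case by (rule exI[of _ "\<lambda>_. 1"]) (simp add: sym_fun_const)
  next
    case (Suc k)
    then obtain g where g: "sym_fun n k g"
      "\<And>x. \<forall>i\<in>{r<..n}. x i = y i \<Longrightarrow> g x = esym {1..r} k x"
      by blast
    obtain h where h: "sym_fun n (Suc k) h"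
      "\<And>x. \<forall>i\<in>{Suc r<..n}. x i = y i \<Longrightarrow> h x = esym {1..Suc r} (Suc k) x"
      using step.IH by blast
    have "sym_fun n (Suc k) (\<lambda>x. h x - y (Suc r) * g x)"
      by (intro sym_fun_diff h sym_fun_cmult sym_fun.mono[OF g(1)]) simp
    moreover have "h x - y (Suc r) * g x = esym {1..r} (Suc k) x" if "\<forall>i\<in>{r<..n}. x i = y i" for x
    proof -
      have "h x = esym (insert (Suc r) {1..r}) (Suc k) x"
        using h(2)[of x] that by (simp add: atLeastAtMostSuc_conv)
      also have "\<dots> = esym {1..r} (Suc k) x + y (Suc r) * esym {1..r} k x"
        using that step.hyps by (subst esym_insert) auto
      finally show ?thesis
        using g(2)[OF that] by simp
    qed
    ultimately show ?case by (intro exI[of _ "\<lambda>x. h x - y (Suc r) * g x"]) auto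
  qed
qed

lemma initial_prod_sym_fun:
  fixes y :: "nat \<Rightarrow> 'a::field"
  assumes "r \<le> n"
  shows "\<exists>g. sym_fun n r g \<and> (\<forall>x. (\<forall>i\<in>{r<..n}. x i = y i) \<longrightarrow> g x = (\<Prod>i=1..r. x i - c))"
proof -
  obtain G where G: "\<And>k. sym_fun n k (G k)"
    "\<And>k x. \<forall>i\<in>{r<..n}. x i = y i \<Longrightarrow> G k x = esym {1..r} k x"
    using esym_initial_sym_fun[OF assms, of _ y] by metis
  define g where "g x = (\<Sum>k\<le>r. ((-1) ^ r * ((-1) ^ k * c ^ (r - k))) * G k x)" for x
  have "sym_fun n r g"
    unfolding g_def by (intro sym_fun_sum sym_fun_cmult sym_fun.mono[OF G(1)]) simp
  moreover have "g x = (\<Prod>i=1..r. x i - c)" if x: "\<forall>i\<in>{r<..n}. x i = y i" for x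
  proof -
    have "(\<Prod>i=1..r. x i - c) = (\<Prod>i=1..r. - (c - x i))" by simp
    also have "\<dots> = (-1) ^ r * (\<Prod>i=1..r. c - x i)"
      by (subst prod_uminus) simp
    also have "\<dots> = g x"
      by (simp add: prod_diff_eq_esym g_def G(2)[OF x] sum_distrib_left mult_ac)
    finally show ?thesis by simp
  qed
  ultimately show ?thesis by blast
qed

section \<open>The cone\<close>

abbreviation of_nat_poly :: "nat poly \<Rightarrow> rat poly" where
  "of_nat_poly \<equiv> map_poly of_nat"

lemma of_nat_poly_add: "of_nat_poly (f + g) = of_nat_poly f + of_nat_poly g"
  by (rule poly_eqI) (simp add: coeff_map_poly)

lemma of_nat_poly_mult: "of_nat_poly (f * g) = of_nat_poly f * of_nat_poly g"
  by (rule poly_eqI) (simp add: coeff_map_poly coeff_mult)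

lemma of_nat_poly_eq_0_iff: "of_nat_poly f = 0 \<longleftrightarrow> f = 0"
  by (rule map_poly_eq_0_iff) auto

lemma nonneg_coneE:
  assumes "x \<in> nonneg_cone"
  obtains f g where "g \<noteq> 0" and "x = Fract (of_nat_poly f) (of_nat_poly g)"
  using assms by (auto simp: nonneg_cone_def)

lemma nonneg_coneI: "g \<noteq> 0 \<Longrightarrow> Fract (of_nat_poly f) (of_nat_poly g) \<in> nonneg_cone"
  by (auto simp: nonneg_cone_def)

lemma cone_add:
  assumes "x \<in> nonneg_cone" and "y \<in> nonneg_cone"
  shows "x + y \<in> nonneg_cone"
proof -
  obtain f g where x: "g \<noteq> 0" "x = Fract (of_nat_poly f) (of_nat_poly g)"
    using assms(1) by (rule nonneg_coneE)
  obtain f' g' where y: "g' \<noteq> 0" "y = Fract (of_nat_poly f') (of_nat_poly g')"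
    using assms(2) by (rule nonneg_coneE)
  have "x + y = Fract (of_nat_poly (f * g' + f' * g)) (of_nat_poly (g * g'))"
    using x y by (simp add: of_nat_poly_add of_nat_poly_mult of_nat_poly_eq_0_iff)
  then show ?thesis
    using x(1) y(1) nonneg_coneI[of "g * g'"] by simp
qed

lemma cone_mult:
  assumes "x \<in> nonneg_cone" and "y \<in> nonneg_cone"
  shows "x * y \<in> nonneg_cone"
proof -
  obtain f g where x: "g \<noteq> 0" "x = Fract (of_nat_poly f) (of_nat_poly g)"
    using assms(1) by (rule nonneg_coneE)
  obtain f' g' where y: "g' \<noteq> 0" "y = Fract (of_nat_poly f') (of_nat_poly g')"
    using assms(2) by (rule nonneg_coneE)
  have "x * y = Fract (of_nat_poly (f * f')) (of_nat_poly (g * g'))"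
    using x y by (simp add: of_nat_poly_mult)
  then show ?thesis
    using x(1) y(1) nonneg_coneI[of "g * g'"] by simp
qed

lemma lin_eq_Fract:
  "of_nat a + of_nat b * tau = Fract (of_nat_poly [:a, b:]) (of_nat_poly 1)"
  by (simp add: tau_def of_nat_fract map_poly_pCons of_nat_poly)

lemma cone_lin: "of_nat a + of_nat b * tau \<in> nonneg_cone"
  unfolding lin_eq_Fract by (rule nonneg_coneI) simp

lemma lin_eq_0_iff: "(of_nat a + of_nat b * tau :: base_field) = 0 \<longleftrightarrow> a = 0 \<and> b = 0"
proof -
  have "(of_nat a + of_nat b * tau :: base_field) = 0 \<longleftrightarrow> of_nat_poly [:a, b:] = 0"
    unfolding lin_eq_Fract by (simp add: Zero_fract_def eq_fract)
  then show ?thesis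
    unfolding of_nat_poly_eq_0_iff by simp
qed

lemma cone_of_nat: "of_nat a \<in> nonneg_cone"
  using cone_lin[of a 0] by simp

lemma cone_0: "0 \<in> nonneg_cone"
  using cone_of_nat[of 0] by simp

lemma cone_1: "1 \<in> nonneg_cone"
  using cone_of_nat[of 1] by simp

lemma cone_tau: "tau \<in> nonneg_cone"
  using cone_lin[of 0 1] by simp

lemma tau_neq_0: "tau \<noteq> 0"
  using lin_eq_0_iff[of 0 1] by simp

lemma of_nat_base_field_neq_0: "0 < k \<Longrightarrow> (of_nat k :: base_field) \<noteq> 0"
  using lin_eq_0_iff[of k 0] by simp

lemma cone_divide:
  assumes "x \<in> nonneg_cone" and "y \<in> nonneg_cone"
  shows "x / y \<in> nonneg_cone"
proof -
  obtain f g where y: "g \<noteq> 0" "y = Fract (of_nat_poly f) (of_nat_poly g)"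
    using assms(2) by (rule nonneg_coneE)
  have "inverse y \<in> nonneg_cone"
  proof (cases "f = 0")
    case True
    then have "y = 0" using y by (simp add: fract_collapse)
    then show ?thesis by (simp add: cone_0)
  next
    case False
    then show ?thesis
      using y(2) nonneg_coneI[of f g] by simp
  qed
  then show ?thesis
    using cone_mult[OF assms(1)] by (simp add: divide_inverse)
qed

lemma cone_sum: "(\<And>i. i \<in> I \<Longrightarrow> f i \<in> nonneg_cone) \<Longrightarrow> (\<Sum>i\<in>I. f i) \<in> nonneg_cone"
  by (induction I rule: infinite_finite_induct) (auto intro: cone_0 cone_add)

lemma cone_prod: "(\<And>i. i \<in> I \<Longrightarrow> f i \<in> nonneg_cone) \<Longrightarrow> (\<Prod>i\<in>I. f i) \<in> nonneg_cone"
  by (induction I rule: infinite_finite_induct) (auto intro: cone_1 cone_mult)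

section \<open>Partitions and the weights of the lowering operator\<close>

lemma partitions_antimono: "l \<in> partitions n \<Longrightarrow> 1 \<le> i \<Longrightarrow> i \<le> j \<Longrightarrow> l j \<le> l i"
  by (cases "j \<le> n") (auto simp: partitions_def)

lemma partitions_outside: "l \<in> partitions n \<Longrightarrow> i \<notin> {1..n} \<Longrightarrow> l i = 0"
  by (auto simp: partitions_def)

lemma partitions_eqI:
  "l \<in> partitions n \<Longrightarrow> m \<in> partitions n \<Longrightarrow> (\<And>i. i \<in> {1..n} \<Longrightarrow> l i = m i) \<Longrightarrow> l = m"
  by (rule ext) (metis partitions_outside)

definition remove_box :: "nat \<Rightarrow> (nat \<Rightarrow> nat) \<Rightarrow> nat \<Rightarrow> nat" where
  "remove_box i l = l(i := l i - 1)"

lemma remove_box_partitions: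
  assumes "l \<in> partitions n" and "i \<in> {1..n}" and "l (Suc i) < l i"
  shows "remove_box i l \<in> partitions n"
proof -
  have "l b - (if b = i then 1 else 0) \<le> l a - (if a = i then 1 else 0)" if "1 \<le> a" "a \<le> b" for a b
  proof (cases "a = i \<and> b \<noteq> i")
    case True
    then have "l b \<le> l (Suc i)"
      using that partitions_antimono[OF assms(1), of "Suc i" b] by simp
    then show ?thesis using True assms(3) by auto
  next
    case False
    then show ?thesis
      using partitions_antimono[OF assms(1) that] by auto
  qed
  moreover have "remove_box i l j = 0" if "j \<notin> {1..n}" for j
    using partitions_outside[OF assms(1) that] assms(2) that by (auto simp: remove_box_def)
  moreover have "remove_box i l j = l j - (if j = i then 1 else 0)" for j
    by (simp add: remove_box_def)
  ultimately show ?thesis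
    by (simp add: partitions_def)
qed

lemma psize_remove_box:
  assumes "i \<in> {1..n}" and "0 < l i"
  shows "psize n l = Suc (psize n (remove_box i l))"
proof -
  have "psize n l = l i + (\<Sum>j\<in>{1..n} - {i}. l j)"
    unfolding psize_def using assms(1) by (intro sum.remove) auto
  moreover have "psize n (remove_box i l) = (l i - 1) + (\<Sum>j\<in>{1..n} - {i}. l j)"
    unfolding psize_def using assms(1) by (subst sum.remove[of _ i]) (auto simp: remove_box_def)
  ultimately show ?thesis
    using assms(2) by simp
qed

lemma shifted_remove_box:
  "0 < l i \<Longrightarrow> shifted n (remove_box i l) = (shifted n l)(i := shifted n l i - 1)"
  by (auto simp: shifted_def remove_box_def fun_eq_iff of_nat_diff)

lemma shifted_diff:
  assumes "l \<in> partitions n" and "1 \<le> i" and "i < j" and "j \<le> n"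
  shows "shifted n l i - shifted n l j = of_nat (l i - l j) + of_nat (j - i) * tau"
proof -
  have "l j \<le> l i"
    using partitions_antimono[OF assms(1), of i j] assms by simp
  moreover have "n - i = (n - j) + (j - i)"
    using assms by simp
  ultimately show ?thesis
    by (simp add: shifted_def of_nat_diff algebra_simps del: diff_diff_left add_diff_assoc)
qed

lemma inj_on_shifted:
  assumes "l \<in> partitions n"
  shows "inj_on (shifted n l) {1..n}"
proof (rule linorder_inj_onI)
  fix i j assume "i < j" "i \<in> {1..n}" "j \<in> {1..n}"
  then have "shifted n l i - shifted n l j \<noteq> 0"
    using shifted_diff[OF assms, of i j] lin_eq_0_iff[of "l i - l j" "j - i"] by simp
  then show "shifted n l i \<noteq> shifted n l j" by simp
qed auto

abbreviation weight :: "nat \<Rightarrow> nat \<Rightarrow> (nat \<Rightarrow> nat) \<Rightarrow> base_field" where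
  "weight n i l \<equiv> lower_weight tau n i (shifted n l)"

text \<open>For both orders of \<open>i\<close> and \<open>j\<close>, numerator and denominator are, up to a common sign, of the form
  \<open>a + b\<tau>\<close> with natural \<open>a\<close>, \<open>b\<close>.\<close>
lemma cone_weight_factor:
  assumes l: "l \<in> partitions n" and "i \<in> {1..n}" and "j \<in> {1..n} - {i}"
  shows "(shifted n l i - shifted n l j - tau) / (shifted n l i - shifted n l j) \<in> nonneg_cone"
proof (cases "i < j")
  case True
  let ?a = "l i - l j" and ?b = "j - i - 1"
  have "shifted n l i - shifted n l j = of_nat ?a + of_nat (Suc ?b) * tau"
    using shifted_diff[OF l, of i j] True assms by simp
  moreover from this have "shifted n l i - shifted n l j - tau = of_nat ?a + of_nat ?b * tau"
    by (simp add: algebra_simps)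
  ultimately show ?thesis
    by (simp only: cone_divide cone_lin)
next
  case False
  let ?a = "l j - l i" and ?b = "i - j"
  have d: "shifted n l j - shifted n l i = of_nat ?a + of_nat ?b * tau"
    using shifted_diff[OF l, of j i] False assms by simp
  then have "shifted n l j - shifted n l i + tau = of_nat ?a + of_nat (Suc ?b) * tau"
    by (simp add: algebra_simps)
  moreover have "(shifted n l i - shifted n l j - tau) / (shifted n l i - shifted n l j)
      = (shifted n l j - shifted n l i + tau) / (shifted n l j - shifted n l i)"
    using minus_divide_divide[of "shifted n l j - shifted n l i + tau" "shifted n l j - shifted n l i"]
    by (simp add: algebra_simps)
  ultimately show ?thesis
    using d by (simp only: cone_divide cone_lin)
qed

lemma cone_shifted: "shifted n l i \<in> nonneg_cone"
  unfolding shifted_def by (rule cone_lin)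

lemma cone_weight:
  assumes "l \<in> partitions n" and "i \<in> {1..n}"
  shows "weight n i l \<in> nonneg_cone"
  unfolding lower_weight_def
  by (intro cone_mult cone_prod cone_shifted cone_weight_factor assms)

text \<open>If row \<open>i\<close> has the same length as row \<open>i + 1\<close>, the factor for \<open>j = i + 1\<close> vanishes; for \<open>i = n\<close> the
  factor \<open>x\<^sub>n\<close> in front does.\<close>
lemma weight_eq_0:
  assumes l: "l \<in> partitions n" and i: "i \<in> {1..n}" and "\<not> l (Suc i) < l i"
  shows "weight n i l = 0"
proof -
  have eq: "l (Suc i) = l i"
    using partitions_antimono[OF l, of i "Suc i"] assms by simp
  show ?thesis
  proof (cases "i = n")
    case True
    then have "l i = 0"
      using eq partitions_outside[OF l, of "Suc i"] by simp
    then show ?thesis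
      using True by (simp add: lower_weight_def shifted_def)
  next
    case False
    then have "Suc i \<in> {1..n} - {i}"
      using i by auto
    moreover have "shifted n l i - shifted n l (Suc i) - tau = 0"
      using shifted_diff[OF l, of i "Suc i"] False i eq by simp
    ultimately have "(\<Prod>j\<in>{1..n} - {i}. (shifted n l i - shifted n l j - tau)
        / (shifted n l i - shifted n l j)) = 0"
      by (intro prod_zero bexI[of _ "Suc i"]) simp_all
    then show ?thesis
      by (simp add: lower_weight_def)
  qed
qed

text \<open>Only the factor for row \<open>p\<close> changes, from \<open>1 - \<tau>/y\<close> to \<open>1 - \<tau>/(y + 1)\<close> where \<open>y = x\<^sub>q - x\<^sub>p\<close>. The
  difference is \<open>\<tau>/(y (y + 1))\<close>. Either \<open>y\<close> and \<open>y + 1\<close> are both in the cone, or, for \<open>p < q\<close>, both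
  are negatives of elements of the cone: then row \<open>p\<close> is longer than row \<open>q\<close> because the removed box
  is a corner.\<close>
lemma cone_weight_remove_box_diff:
  assumes l: "l \<in> partitions n" and p: "p \<in> {1..n}" "l (Suc p) < l p" and q: "q \<in> {1..n}" "q \<noteq> p"
  shows "weight n q (remove_box p l) - weight n q l \<in> nonneg_cone"
proof -
  let ?x = "shifted n l" and ?A = "{1..n} - {q} - {p}"
  define F where "F = ?x q * (\<Prod>j\<in>?A. (?x q - ?x j - tau) / (?x q - ?x j))"
  define y where "y = ?x q - ?x p"
  have pA: "finite ({1..n} - {q})" "p \<in> {1..n} - {q}"
    using p q by auto
  have wl: "weight n q l = F * ((y - tau) / y)"
    unfolding lower_weight_def prod.remove[OF pA] F_def y_def by simp
  have wr: "weight n q (remove_box p l) = F * ((y + 1 - tau) / (y + 1))"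
  proof -
    have "(\<Prod>j\<in>?A. (?x q - (?x(p := ?x p - 1)) j - tau) / (?x q - (?x(p := ?x p - 1)) j))
        = (\<Prod>j\<in>?A. (?x q - ?x j - tau) / (?x q - ?x j))"
      by (rule prod.cong) auto
    then show ?thesis
      using p(2) q(2) unfolding lower_weight_def prod.remove[OF pA] F_def y_def
      by (simp add: shifted_remove_box algebra_simps)
  qed
  have F: "F \<in> nonneg_cone"
    unfolding F_def by (intro cone_mult cone_prod cone_shifted cone_weight_factor l q) auto
  have *: "y \<noteq> 0 \<and> y + 1 \<noteq> 0 \<and> y * (y + 1) \<in> nonneg_cone"
  proof (cases "q < p")
    case True
    have y: "y = of_nat (l q - l p) + of_nat (p - q) * tau"
      using shifted_diff[OF l, of q p] True p q by (simp add: y_def)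
    then have y1: "y + 1 = of_nat (Suc (l q - l p)) + of_nat (p - q) * tau"
      by simp
    have "y \<noteq> 0" "y + 1 \<noteq> 0"
      unfolding y1 unfolding y lin_eq_0_iff using True by auto
    then show ?thesis
      unfolding y1 unfolding y by (intro conjI cone_mult cone_lin)
  next
    case False
    then have "p < q" using q by simp
    have "l q \<le> l (Suc p)"
      using partitions_antimono[OF l, of "Suc p" q] \<open>p < q\<close> by simp
    then have a: "l p - l q = Suc (l p - l q - 1)"
      using p(2) by simp
    have y: "- y = of_nat (l p - l q) + of_nat (q - p) * tau"
      using shifted_diff[OF l, of p q] \<open>p < q\<close> p q by (simp add: y_def)
    then have y1: "- (y + 1) = of_nat (l p - l q - 1) + of_nat (q - p) * tau"
    proof -
      have "(of_nat (l p - l q) :: base_field) = 1 + of_nat (l p - l q - 1)"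
        by (subst a) simp
      moreover have "- (y + 1) = - y - 1" by simp
      ultimately show ?thesis
        unfolding y by simp
    qed
    have "- y \<noteq> 0" "- (y + 1) \<noteq> 0"
      unfolding y1 unfolding y lin_eq_0_iff using \<open>p < q\<close> by auto
    moreover have "(- y) * (- (y + 1)) \<in> nonneg_cone"
      unfolding y1 unfolding y by (intro cone_mult cone_lin)
    ultimately show ?thesis
      by (simp only: minus_mult_minus neg_equal_0_iff_equal simp_thms)
  qed
  then have "(y + 1 - tau) / (y + 1) - (y - tau) / y = tau / (y * (y + 1))"
    by (simp add: field_simps)
  then have "weight n q (remove_box p l) - weight n q l = F * (tau / (y * (y + 1)))"
    unfolding wl wr right_diff_distrib[symmetric] by simp
  then show ?thesis
    using * F by (simp only: cone_mult cone_divide cone_tau)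
qed

section \<open>Interpolation at shifted partitions\<close>

lemma finite_partitions_le: "finite {l \<in> partitions n. psize n l \<le> d}"
proof (rule finite_subset)
  show "finite {l. \<forall>i. (i \<in> {1..n} \<longrightarrow> l i \<in> {..d}) \<and> (i \<notin> {1..n} \<longrightarrow> l i = (0::nat))}"
    by (rule finite_set_of_finite_funs) auto
  show "{l \<in> partitions n. psize n l \<le> d}
      \<subseteq> {l. \<forall>i. (i \<in> {1..n} \<longrightarrow> l i \<in> {..d}) \<and> (i \<notin> {1..n} \<longrightarrow> l i = 0)}"
  proof (intro subsetI CollectI allI conjI impI)
    fix l i assume l: "l \<in> {l \<in> partitions n. psize n l \<le> d}"
    {
      assume "i \<in> {1..n}"
      then have "l i \<le> psize n l"
        unfolding psize_def by (intro member_le_sum) auto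
      then show "l i \<in> {..d}" using l by simp
    }
    assume "i \<notin> {1..n}"
    then show "l i = 0"
      using l partitions_outside by blast
  qed
qed

text \<open>Both sides count the boxes; the left side does so by columns, \<open>l r - l (Suc r)\<close> of which have height \<open>r\<close>.\<close>
lemma sum_column_heights:
  assumes "l \<in> partitions n"
  shows "(\<Sum>r=1..n. (l r - l (Suc r)) * r) = psize n l"
proof -
  have "(\<Sum>r=1..m. (l r - l (Suc r)) * r) + m * l (Suc m) = (\<Sum>r=1..m. l r)" for m
  proof (induction m)
    case (Suc m)
    have "l (Suc (Suc m)) \<le> l (Suc m)"
      using partitions_antimono[OF assms] by simp
    then obtain c where "l (Suc m) = l (Suc (Suc m)) + c"
      using le_Suc_ex by blast
    with Suc show ?case by (simp add: algebra_simps)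
  qed simp
  from this[of n] show ?thesis
    using partitions_outside[OF assms, of "Suc n"] by (simp add: psize_def)
qed

text \<open>One factor for each column: for the column number \<open>c\<close> of height \<open>r\<close>, counted from \<open>0\<close>, a symmetric
  function of degree \<open>r\<close> which equals \<open>\<Prod>\<^bsub>i \<le> r\<^esub> (x\<^sub>i - c - (n - r)\<tau>)\<close> whenever the rows after \<open>r\<close> have
  the same lengths as in \<open>k\<close>. If moreover row \<open>r\<close> of \<open>l\<close> is shorter than that of \<open>k\<close>, then
  \<open>c = l r\<close> is among these columns and its factor vanishes at \<open>l\<close>.\<close>
lemma ex_triangular_sym_fun:
  assumes k: "k \<in> partitions n"
  shows "\<exists>g. sym_fun n (psize n k) g \<and> g (shifted n k) \<noteq> 0 \<and>
    (\<forall>l\<in>partitions n. \<forall>r\<in>{1..n}. l r < k r \<longrightarrow> (\<forall>i\<in>{r<..n}. l i = k i) \<longrightarrow> g (shifted n l) = 0)"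
proof -
  define c' where "c' r c = (of_nat c + of_nat (n - r) * tau :: base_field)" for r c
  have "\<exists>g. sym_fun n r g \<and> (\<forall>x. (\<forall>i\<in>{r<..n}. x i = shifted n k i) \<longrightarrow>
      g x = (\<Prod>i=1..r. x i - c' r c))" if "r \<in> {1..n}" for r c
    using that by (intro initial_prod_sym_fun) simp
  then obtain G where G: "\<And>r c. r \<in> {1..n} \<Longrightarrow> sym_fun n r (G r c)"
    "\<And>r c x. r \<in> {1..n} \<Longrightarrow> \<forall>i\<in>{r<..n}. x i = shifted n k i \<Longrightarrow> G r c x = (\<Prod>i=1..r. x i - c' r c)"
    by metis
  define g where "g x = (\<Prod>r=1..n. \<Prod>c\<in>{k (Suc r)..<k r}. G r c x)" for x
  have "sym_fun n (\<Sum>r=1..n. \<Sum>c\<in>{k (Suc r)..<k r}. r) g"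
    unfolding g_def by (intro sym_fun_prod G)
  then have "sym_fun n (psize n k) g"
    using sum_column_heights[OF k] by simp
  moreover have "g (shifted n k) \<noteq> 0"
  proof -
    have "shifted n k i - c' r c \<noteq> 0" if "r \<in> {1..n}" "c < k r" "i \<in> {1..r}" for r c i
    proof -
      have "k r \<le> k i"
        using partitions_antimono[OF k] that by simp
      then have "c < k i"
        using that by simp
      have "n - i = (n - r) + (r - i)"
        using that by simp
      then have "shifted n k i - c' r c = of_nat (k i - c) + of_nat (r - i) * tau"
        using \<open>c < k i\<close>
        by (simp add: shifted_def c'_def of_nat_diff algebra_simps del: diff_diff_left add_diff_assoc)
      then show ?thesis
        using lin_eq_0_iff[of "k i - c" "r - i"] \<open>c < k i\<close> by simp
    qed
    then show ?thesis
      by (auto simp: g_def G(2))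
  qed
  moreover have "g (shifted n l) = 0"
    if l: "l \<in> partitions n" and r: "r \<in> {1..n}" and less: "l r < k r" and tail: "\<forall>i\<in>{r<..n}. l i = k i"
    for l r
  proof -
    have "k (Suc r) \<le> l r"
    proof (cases "r = n")
      case True
      then show ?thesis using partitions_outside[OF k, of "Suc r"] by simp
    next
      case False
      then have "k (Suc r) = l (Suc r)"
        using tail r by simp
      then show ?thesis
        using partitions_antimono[OF l, of r "Suc r"] r by simp
    qed
    then have c: "l r \<in> {k (Suc r)..<k r}"
      using less by simp
    have "G r (l r) (shifted n l) = (\<Prod>i=1..r. shifted n l i - c' r (l r))"
      using tail by (intro G(2) r) (simp add: shifted_def)
    also have "\<dots> = 0"
      using r by (intro prod_zero bexI[of _ r]) (auto simp: shifted_def c'_def)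
    finally have "(\<Prod>c\<in>{k (Suc r)..<k r}. G r c (shifted n l)) = 0"
      using c by (intro prod_zero) auto
    then show ?thesis
      unfolding g_def using r by (intro prod_zero) auto
  qed
  ultimately show ?thesis by blast
qed

text \<open>A maximum for the lexicographic order that compares the last coordinate first.\<close>
lemma ex_last_lex_max:
  fixes Q :: "(nat \<Rightarrow> nat) set"
  assumes "finite Q" and "Q \<noteq> {}"
  shows "\<exists>k\<in>Q. \<forall>l\<in>Q. (\<forall>i\<in>{1..n}. l i = k i) \<or>
    (\<exists>r\<in>{1..n}. l r < k r \<and> (\<forall>i\<in>{r<..n}. l i = k i))"
  using assms
proof (induction n arbitrary: Q)
  case 0
  then show ?case by auto
next
  case (Suc n)
  define m where "m = Max ((\<lambda>l. l (Suc n)) ` Q)"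
  define Q' where "Q' = {l \<in> Q. l (Suc n) = m}"
  have "m \<in> (\<lambda>l. l (Suc n)) ` Q"
    unfolding m_def using Suc.prems by (intro Max_in) auto
  then have Q': "finite Q'" "Q' \<noteq> {}"
    using Suc.prems by (auto simp: Q'_def)
  obtain k where k: "k \<in> Q'" "\<And>l. l \<in> Q' \<Longrightarrow> (\<forall>i\<in>{1..n}. l i = k i) \<or>
      (\<exists>r\<in>{1..n}. l r < k r \<and> (\<forall>i\<in>{r<..n}. l i = k i))"
    using Suc.IH[OF Q'] by blast
  have "(\<forall>i\<in>{1..Suc n}. l i = k i) \<or>
      (\<exists>r\<in>{1..Suc n}. l r < k r \<and> (\<forall>i\<in>{r<..Suc n}. l i = k i))" if l: "l \<in> Q" for l
  proof (cases "l (Suc n) = m")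
    case True
    then have "l \<in> Q'" and e: "l (Suc n) = k (Suc n)"
      using l k(1) by (auto simp: Q'_def)
    from k(2)[OF this(1)] show ?thesis
    proof
      assume "\<forall>i\<in>{1..n}. l i = k i"
      then have "\<forall>i\<in>{1..Suc n}. l i = k i"
        using e by (auto simp: le_Suc_eq)
      then show ?thesis ..
    next
      assume "\<exists>r\<in>{1..n}. l r < k r \<and> (\<forall>i\<in>{r<..n}. l i = k i)"
      then obtain r where "r \<in> {1..n}" "l r < k r" "\<forall>i\<in>{r<..n}. l i = k i"
        by blast
      then have "r \<in> {1..Suc n} \<and> l r < k r \<and> (\<forall>i\<in>{r<..Suc n}. l i = k i)"
        using e by (auto simp: le_Suc_eq)
      then show ?thesis by blast
    qed
  next
    case False
    have "l (Suc n) \<le> m"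
      unfolding m_def using Suc.prems l by (intro Max_ge) auto
    then have "l (Suc n) < k (Suc n)"
      using False k(1) by (simp add: Q'_def)
    then have "Suc n \<in> {1..Suc n} \<and> l (Suc n) < k (Suc n) \<and> (\<forall>i\<in>{Suc n<..Suc n}. l i = k i)"
      by simp
    then show ?thesis by blast
  qed
  moreover have "k \<in> Q"
    using k(1) by (simp add: Q'_def)
  ultimately show ?case by blast
qed

text \<open>Induction on the set of nodes: the triangular function of the greatest node corrects the value there
  and vanishes at all other nodes.\<close>
lemma ex_interpolation:
  assumes "finite Q" and "Q \<subseteq> {l \<in> partitions n. psize n l \<le> d}"
  shows "\<exists>g. sym_fun n d g \<and> (\<forall>l\<in>Q. g (shifted n l) = v l)"
  using assms
proof (induction Q rule: finite_psubset_induct)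
  case (psubset Q)
  show ?case
  proof (cases "Q = {}")
    case True
    then show ?thesis using sym_fun_const by blast
  next
    case False
    obtain k where k: "k \<in> Q" "\<And>l. l \<in> Q \<Longrightarrow> (\<forall>i\<in>{1..n}. l i = k i) \<or>
        (\<exists>r\<in>{1..n}. l r < k r \<and> (\<forall>i\<in>{r<..n}. l i = k i))"
      using ex_last_lex_max[OF psubset.hyps False] by blast
    have kp: "k \<in> partitions n" "psize n k \<le> d"
      using k(1) psubset.prems by auto
    obtain g where g: "sym_fun n d g" "\<And>l. l \<in> Q - {k} \<Longrightarrow> g (shifted n l) = v l"
      using psubset.IH[of "Q - {k}"] k(1) psubset.prems by blast
    obtain f where f: "sym_fun n (psize n k) f" "f (shifted n k) \<noteq> 0"
      "\<And>l r. l \<in> partitions n \<Longrightarrow> r \<in> {1..n} \<Longrightarrow> l r < k r \<Longrightarrow> \<forall>i\<in>{r<..n}. l i = k i \<Longrightarrow>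
        f (shifted n l) = 0"
      using ex_triangular_sym_fun[OF kp(1)] by blast
    define c where "c = (v k - g (shifted n k)) / f (shifted n k)"
    have "sym_fun n d (\<lambda>x. g x + c * f x)"
      by (intro sym_fun.add sym_fun_cmult g sym_fun.mono[OF f(1)] kp)
    moreover have "g (shifted n l) + c * f (shifted n l) = v l" if l: "l \<in> Q" for l
    proof (cases "l = k")
      case True
      then show ?thesis using f(2) by (simp add: c_def)
    next
      case False
      have lp: "l \<in> partitions n"
        using l psubset.prems by auto
      have "f (shifted n l) = 0"
        using k(2)[OF l] False partitions_eqI[OF lp kp(1)] f(3)[OF lp] by blast
      then show ?thesis
        using g(2) l False by simp
    qed
    ultimately show ?thesis by blast
  qed
qed

lemma lookup_scale:
  fixes p :: "'a::comm_semiring_1 mpoly"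
  shows "Poly_Mapping.lookup (Poly_Mapping.single 0 c * p) m = c * Poly_Mapping.lookup p m"
  unfolding mult_map_scale_conv_mult[symmetric]
  by (simp add: Poly_Mapping.map.rep_eq when_def)

lemma total_degree_scale_le:
  fixes p :: "'a::comm_semiring_1 mpoly"
  shows "total_degree p \<le> d \<Longrightarrow> total_degree (Poly_Mapping.single 0 c * p) \<le> d"
  by (auto simp: total_degree_le_iff in_keys_iff lookup_scale)

text \<open>Let \<open>N\<close> be the number of partitions of size at most \<open>d\<close>. The functions dual to the \<open>N\<close> nodes, together with
  \<open>p\<close>, are \<open>N + 1\<close> elements of a space on which \<open>N\<close> coefficients are a complete set of coordinates.
  They are linearly dependent; evaluating the relation at the nodes shows that only \<open>p\<close> occurs in it.\<close>
lemma sym_poly_vanishing_eq_0: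
  assumes p: "p \<in> sym_polys n" "total_degree p \<le> d"
    and z: "\<And>l. l \<in> partitions n \<Longrightarrow> psize n l \<le> d \<Longrightarrow> mpoly_eval (shifted n l) p = 0"
  shows "p = 0"
proof -
  define P where "P = {l \<in> partitions n. psize n l \<le> d}"
  have finP: "finite P"
    unfolding P_def by (rule finite_partitions_le)
  have "\<exists>h\<in>sym_polys n. total_degree h \<le> d \<and>
      (\<forall>l\<in>P. mpoly_eval (shifted n l) h = (if l = k then 1 else 0))" for k
  proof -
    obtain g where g: "sym_fun n d g" "\<forall>l\<in>P. g (shifted n l) = (if l = k then 1 else 0)"
      using ex_interpolation[OF finP, of n d "\<lambda>l. if l = k then 1 else 0"] by (auto simp: P_def)
    then show ?thesis
      using sym_fun_imp_mpoly[OF g(1)] by metis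
  qed
  then obtain H where H: "\<And>k. H k \<in> sym_polys n" "\<And>k. total_degree (H k) \<le> d"
    "\<And>k l. l \<in> P \<Longrightarrow> mpoly_eval (shifted n l) (H k) = (if l = k then 1 else 0)"
    by metis
  define I where "I = insert None (Some ` P)"
  define F where "F i = (case i of None \<Rightarrow> p | Some k \<Rightarrow> H k)" for i
  have F: "F i \<in> sym_polys n" "total_degree (F i) \<le> d" for i
    using p H by (auto simp: F_def split: option.split)
  have finI: "finite I" and cardI: "card P < card I"
    using finP by (auto simp: I_def card_insert_if card_image)
  obtain a where a: "\<exists>i\<in>I. a i \<noteq> 0"
    "\<And>k. k \<in> P \<Longrightarrow> (\<Sum>i\<in>I. a i * Poly_Mapping.lookup (F i) (Poly_Mapping.Abs_poly_mapping k)) = 0"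
    using ex_linear_relation[OF finP finI cardI,
        of "\<lambda>i k. Poly_Mapping.lookup (F i) (Poly_Mapping.Abs_poly_mapping k)"] by blast
  define R where "R J = (\<Sum>i\<in>J. Poly_Mapping.single 0 (a i) * F i)" for J
  have RJ: "R J \<in> sym_polys n \<and> total_degree (R J) \<le> d" if "finite J" for J
    using that unfolding R_def
  proof (induction J rule: finite_induct)
    case empty
    show ?case using sym_polys_single_0[of 0 n] by (simp add: total_degree_le_iff)
  next
    case (insert j J)
    then show ?case
      by (simp add: sym_polys_add sym_polys_mult sym_polys_single_0 total_degree_add_le
          total_degree_scale_le F)
  qed
  have "R I = 0"
  proof (rule sym_poly_eq_0I)
    show "R I \<in> sym_polys n" "total_degree (R I) \<le> d"
      using RJ[OF finI] by auto
    fix l assume "l \<in> partitions n" "psize n l \<le> d"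
    then have "l \<in> P" by (simp add: P_def)
    then show "Poly_Mapping.lookup (R I) (Poly_Mapping.Abs_poly_mapping l) = 0"
      using a(2) by (simp add: R_def lookup_sum lookup_scale)
  qed
  have split: "R I = Poly_Mapping.single 0 (a None) * p + (\<Sum>k\<in>P. Poly_Mapping.single 0 (a (Some k)) * H k)"
    using finP by (simp add: R_def I_def F_def sum.reindex)
  have aS: "a (Some l) = 0" if l: "l \<in> P" for l
  proof -
    have "mpoly_eval (shifted n l) (R I) = (\<Sum>k\<in>P. if l = k then a (Some k) else 0)"
      using l z unfolding split
      by (simp add: mpoly_eval_add mpoly_eval_mult mpoly_eval_sum mpoly_eval_single H(3) P_def
          if_distrib cong: if_cong)
    then show ?thesis
      using \<open>R I = 0\<close> finP l by simp
  qed
  then have "a None \<noteq> 0"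
    using a(1) by (auto simp: I_def)
  have "Poly_Mapping.single 0 (a None) * p = 0"
    using \<open>R I = 0\<close> aS by (simp add: split)
  then have "a None * Poly_Mapping.lookup p m = 0" for m
    by (metis lookup_scale lookup_zero)
  then show ?thesis
    using \<open>a None \<noteq> 0\<close> by (intro poly_mapping_eqI) simp
qed

lemma sym_fun_vanishing_eq_0:
  assumes "sym_fun n d f"
    and "\<And>l. l \<in> partitions n \<Longrightarrow> psize n l \<le> d \<Longrightarrow> f (shifted n l) = 0"
  shows "f x = 0"
proof -
  obtain p where p: "p \<in> sym_polys n" "total_degree p \<le> d" "\<And>x. mpoly_eval x p = f x"
    using sym_fun_imp_mpoly[OF assms(1)] by blast
  then have "p = 0"
    using assms(2) by (intro sym_poly_vanishing_eq_0) auto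
  then show ?thesis using p(3)[of x] by simp
qed

text \<open>The description of the interpolation polynomial by \<open>THE\<close> asks for the exact degree \<open>|m|\<close>. A solution of
  smaller degree would vanish at all nodes up to its own degree, hence be zero, although its value at
  \<open>m\<close> is \<open>1\<close>.\<close>
lemma ex_sym_fun_gen_binom:
  assumes m: "m \<in> partitions n"
  shows "\<exists>f. sym_fun n (psize n m) f \<and> (\<forall>l. gen_binom n l m = f (shifted n l)) \<and>
    (\<forall>l\<in>partitions n. psize n l \<le> psize n m \<longrightarrow> f (shifted n l) = (if l = m then 1 else 0))"
proof -
  let ?d = "psize n m"
  let ?Q = "\<lambda>h. h \<in> sym_polys n \<and> total_degree h = ?d \<and>
     (\<forall>l\<in>partitions n. psize n l \<le> ?d \<longrightarrow> mpoly_eval (shifted n l) h = (if l = m then 1 else 0))"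
  obtain f where f: "sym_fun n ?d f"
    "\<forall>l\<in>partitions n. psize n l \<le> ?d \<longrightarrow> f (shifted n l) = (if l = m then 1 else 0)"
    using ex_interpolation[OF finite_partitions_le order_refl, of n ?d "\<lambda>l. if l = m then 1 else 0"]
    by auto
  obtain h where h: "h \<in> sym_polys n" "total_degree h \<le> ?d" "\<And>x. mpoly_eval x h = f x"
    using sym_fun_imp_mpoly[OF f(1)] by blast
  have "total_degree h = ?d"
  proof (rule ccontr)
    assume "total_degree h \<noteq> ?d"
    then have less: "total_degree h < ?d" using h(2) by simp
    \<comment> \<open>All nodes up to the degree of \<open>h\<close> differ from \<open>m\<close>.\<close>
    have "h = 0"
    proof (rule sym_poly_vanishing_eq_0[OF h(1) order_refl])
      fix l assume "l \<in> partitions n" "psize n l \<le> total_degree h"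
      moreover from this have "l \<noteq> m" using less by auto
      ultimately show "mpoly_eval (shifted n l) h = 0"
        using f(2) less by (simp add: h(3))
    qed
    then show False
      using h(3)[of "shifted n m"] f(2) m by simp
  qed
  then have Qh: "?Q h"
    using h f(2) by simp
  have "interp_jack n m = h"
    unfolding interp_jack_def
  proof (rule the_equality)
    show "?Q h" by (rule Qh)
    fix h' assume Qh': "?Q h'"
    define e where "e = h' + Poly_Mapping.single 0 (- 1) * h"
    have "e \<in> sym_polys n"
      unfolding e_def using Qh Qh' by (intro sym_polys_add sym_polys_mult sym_polys_single_0) auto
    moreover have "total_degree e \<le> ?d"
      unfolding e_def using Qh Qh' by (intro total_degree_add_le total_degree_scale_le) auto
    moreover have "mpoly_eval (shifted n l) e = 0" if "l \<in> partitions n" "psize n l \<le> ?d" for l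
      using Qh Qh' that by (simp add: e_def mpoly_eval_add mpoly_eval_mult mpoly_eval_single)
    ultimately have "e = 0"
      by (rule sym_poly_vanishing_eq_0)
    then have "Poly_Mapping.lookup h' k + (- 1) * Poly_Mapping.lookup h k = 0" for k
      by (metis e_def lookup_add lookup_scale lookup_zero)
    then show "h' = h"
      by (intro poly_mapping_eqI) simp
  qed
  then show ?thesis
    using f h(3) by (auto simp: gen_binom_def intro!: exI[of _ f])
qed

text \<open>Applied to \<open>e\<^sub>1\<close>, the lowering operator gives the sum of the weights, which is therefore a polynomial of degree
  \<open>1\<close>. It is enough to know its values at the empty partition and at the partition \<open>(1)\<close>; at the latter
  only the weight of the first row survives, and its product telescopes to \<open>1\<close>.\<close>
lemma sum_weight:
  assumes "n \<ge> 1" and "l \<in> partitions n"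
  shows "(\<Sum>i=1..n. weight n i l) = of_nat (psize n l)"
proof -
  define e :: "(nat \<Rightarrow> base_field) \<Rightarrow> base_field" where "e = esym {1..n} 1"
  define c :: base_field where "c = (\<Sum>i=1..n. of_nat (n - i) * tau)"
  have e: "e x = (\<Sum>i=1..n. x i)" for x
  proof -
    have "{S. S \<subseteq> {1..n} \<and> card S = 1} = (\<lambda>i. {i}) ` {1..n}"
      by (auto simp: card_1_singleton_iff)
    then show ?thesis
      by (simp add: e_def esym_def sum.reindex)
  qed
  have e_shifted: "e (shifted n l) = of_nat (psize n l) + c" for l
    by (simp add: e shifted_def psize_def c_def sum.distrib)
  have "e x - e (x(i := x i - 1)) = 1" if "i \<in> {1..n}" for x i
    unfolding e sum.remove[OF finite_atLeastAtMost that] by simp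
  moreover have "sym_fun n 1 e"
    unfolding e_def by (rule sym_fun.esym)
  ultimately obtain g where g: "sym_fun n 1 g"
    "\<And>x. inj_on x {1..n} \<Longrightarrow> (\<Sum>i=1..n. lower_weight tau n i x) = g x"
    using sym_fun_lowering[OF assms(1) tau_neq_0, of 1 e] by auto
  have "g (shifted n k) = of_nat (psize n k)" if k: "k \<in> partitions n" "psize n k \<le> 1" for k
  proof -
    have w0: "weight n i k = 0" if "i \<in> {1..n}" "k i = 0" for i
      using weight_eq_0[OF k(1)] that by simp
    have "k i = 0" if "i \<in> {1..n} - {1}" for i
    proof (rule ccontr)
      assume "k i \<noteq> 0"
      then have "1 \<le> k i" "k i \<le> k 1"
        using partitions_antimono[OF k(1), of 1 i] that by auto
      moreover have "k 1 + k i \<le> psize n k"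
      proof -
        have "sum k {1, i} \<le> psize n k"
          unfolding psize_def using that assms(1) by (intro sum_mono2) auto
        then show ?thesis using that by simp
      qed
      ultimately show False using k(2) by simp
    qed
    then have k0: "k i = 0" if "i \<noteq> 1" for i
      using that partitions_outside[OF k(1)] by (cases "i \<in> {1..n}") auto
    have "psize n k = k 1"
      unfolding psize_def using assms(1) k0 by (subst sum.remove[of _ 1]) auto
    have "g (shifted n k) = (\<Sum>i=1..n. weight n i k)"
      using g(2) inj_on_shifted[OF k(1)] by simp
    also have "\<dots> = weight n 1 k"
      using assms(1) k0 w0 by (subst sum.remove[of _ 1]) auto
    also have "\<dots> = of_nat (k 1)"
    proof (cases "k 1 = 0")
      case True
      then show ?thesis using w0 assms(1) by simp
    next
      case False
      then have k1: "k 1 = 1"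
        using k(2) \<open>psize n k = k 1\<close> by simp
      have diff: "shifted n k 1 - shifted n k j = 1 + of_nat (j - 1) * tau" if "j \<in> {1..n} - {1}" for j
        using shifted_diff[OF k(1), of 1 j] that k0[of j] k1 by simp
      have tel: "(1 + of_nat m * tau) *
          (\<Prod>j\<in>{1..Suc m} - {1}. (1 + of_nat (j - 1) * tau - tau) / (1 + of_nat (j - 1) * tau)) = 1"
        for m
      proof (induction m)
        case (Suc m)
        have nz: "1 + of_nat (Suc m) * tau \<noteq> 0"
          using lin_eq_0_iff[of 1 "Suc m"] by simp
        have "{1..Suc (Suc m)} - {1} = insert (Suc (Suc m)) ({1..Suc m} - {1})"
          by auto
        then show ?case
          using Suc nz by (simp add: algebra_simps)
      qed simp
      have "weight n 1 k = (1 + of_nat (n - 1) * tau) *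
          (\<Prod>j\<in>{1..n} - {1}. (1 + of_nat (j - 1) * tau - tau) / (1 + of_nat (j - 1) * tau))"
        unfolding lower_weight_def
      proof (intro arg_cong2[of _ _ _ _ "(*)"] prod.cong refl)
        show "shifted n k 1 = 1 + of_nat (n - 1) * tau"
          unfolding shifted_def k1 by simp
      qed (simp only: diff)
      also have "\<dots> = 1"
        using tel[of "n - 1"] assms(1) by simp
      finally show ?thesis using k1 by simp
    qed
    finally show ?thesis using \<open>psize n k = k 1\<close> by simp
  qed
  then have vanish: "g (shifted n k) - (e (shifted n k) - c) = 0"
    if "k \<in> partitions n" "psize n k \<le> 1" for k
    using that unfolding e_shifted by simp
  have "sym_fun n 1 (\<lambda>x. g x - (e x - c))"
    by (intro sym_fun_diff sym_fun_const g \<open>sym_fun n 1 e\<close>)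
  from sym_fun_vanishing_eq_0[OF this vanish]
  have "g (shifted n l) - (e (shifted n l) - c) = 0" .
  then have "g (shifted n l) = of_nat (psize n l)"
    unfolding e_shifted by simp
  then show ?thesis
    using g(2) inj_on_shifted[OF assms(2)] by simp
qed

section \<open>The recursion and monotonicity\<close>

lemma gen_binom_small:
  assumes "l \<in> partitions n" and "m \<in> partitions n" and "psize n l \<le> psize n m"
  shows "gen_binom n l m = (if l = m then 1 else 0)"
  using ex_sym_fun_gen_binom[OF assms(2)] assms(1,3) by metis

text \<open>The function \<open>g\<close> obtained from \<open>h\<^sub>m\<close> by the lowering operator agrees with \<open>|m| h\<^sub>m\<close> at all nodes: for
  \<open>|k| \<le> |m|\<close> the terms at partitions with one box less vanish, and \<open>|k| h\<^sub>m(k) = |m| h\<^sub>m(k)\<close> since both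
  sides are zero for \<open>k \<noteq> m\<close>. By uniqueness they agree everywhere.\<close>
lemma gen_binom_recursion:
  assumes n: "n \<ge> 1" and l: "l \<in> partitions n" and m: "m \<in> partitions n"
  shows "(of_nat (psize n l) - of_nat (psize n m)) * gen_binom n l m
    = (\<Sum>i=1..n. weight n i l * gen_binom n (remove_box i l) m)"
proof -
  let ?d = "psize n m"
  obtain f where f: "sym_fun n ?d f" "\<And>l. gen_binom n l m = f (shifted n l)"
    "\<And>l. l \<in> partitions n \<Longrightarrow> psize n l \<le> ?d \<Longrightarrow> f (shifted n l) = (if l = m then 1 else 0)"
    using ex_sym_fun_gen_binom[OF m] by blast
  obtain g where g: "sym_fun n ?d g" "\<And>x. inj_on x {1..n} \<Longrightarrow>
      (\<Sum>i=1..n. lower_weight tau n i x * (f x - f (x(i := x i - 1)))) = g x"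
    using sym_fun_lowering[OF n tau_neq_0 f(1)] by blast
  have geq: "g (shifted n k) = of_nat (psize n k) * f (shifted n k)
      - (\<Sum>i=1..n. weight n i k * f (shifted n (remove_box i k)))" if k: "k \<in> partitions n" for k
  proof -
    have "g (shifted n k) = (\<Sum>i=1..n. weight n i k *
        (f (shifted n k) - f ((shifted n k)(i := shifted n k i - 1))))"
      using g(2) inj_on_shifted[OF k] by simp
    also have "\<dots> = (\<Sum>i=1..n. weight n i k * (f (shifted n k) - f (shifted n (remove_box i k))))"
    proof (rule sum.cong)
      fix i assume i: "i \<in> {1..n}"
      show "weight n i k * (f (shifted n k) - f ((shifted n k)(i := shifted n k i - 1)))
          = weight n i k * (f (shifted n k) - f (shifted n (remove_box i k)))"
      proof (cases "k (Suc i) < k i")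
        case True
        then show ?thesis by (simp add: shifted_remove_box)
      qed (simp add: weight_eq_0[OF k i])
    qed simp
    also have "\<dots> = (\<Sum>i=1..n. weight n i k) * f (shifted n k)
        - (\<Sum>i=1..n. weight n i k * f (shifted n (remove_box i k)))"
      by (simp add: right_diff_distrib sum_subtractf sum_distrib_right)
    finally show ?thesis
      unfolding sum_weight[OF n k] .
  qed
  have "g x - of_nat ?d * f x = 0" for x
  proof (rule sym_fun_vanishing_eq_0[of n ?d "\<lambda>x. g x - of_nat ?d * f x"])
    show "sym_fun n ?d (\<lambda>x. g x - of_nat ?d * f x)"
      by (intro sym_fun_diff sym_fun_cmult f g)
    fix k assume k: "k \<in> partitions n" "psize n k \<le> ?d"
    have "weight n i k * f (shifted n (remove_box i k)) = 0" if i: "i \<in> {1..n}" for i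
    proof (cases "k (Suc i) < k i")
      case True
      have "remove_box i k \<in> partitions n" "psize n (remove_box i k) < ?d"
        using remove_box_partitions[OF k(1) i True] psize_remove_box[OF i, of k] True k(2) by auto
      then show ?thesis
        using f(3)[of "remove_box i k"] by auto
    qed (simp add: weight_eq_0[OF k(1) i])
    then have "(\<Sum>i=1..n. weight n i k * f (shifted n (remove_box i k))) = 0"
      by (rule sum.neutral[OF ballI])
    then have "g (shifted n k) = of_nat (psize n k) * f (shifted n k)"
      unfolding geq[OF k(1)] by simp
    then show "g (shifted n k) - of_nat ?d * f (shifted n k) = 0"
      by (simp add: f(3)[OF k])
  qed
  then have "g (shifted n l) = of_nat ?d * f (shifted n l)"
    by simp
  then show ?thesis
    unfolding geq[OF l] f(2) by (simp add: algebra_simps)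
qed

text \<open>Induction on \<open>|l|\<close>. The terms \<open>T i\<close> collect what the recursions for \<open>l\<close> and for \<open>k = l - e\<^sub>p\<close> contribute in
  row \<open>i\<close>, where \<open>f(k)\<close> has been distributed over the rows by means of the sums of the weights.
  Regrouped, every term is a combination of differences along single boxes with coefficients in the
  cone.\<close>
lemma gen_binom_remove_box_mono:
  assumes n: "n \<ge> 1" and m: "m \<in> partitions n"
    and "l \<in> partitions n" and "p \<in> {1..n}" and "l (Suc p) < l p"
  shows "gen_binom n l m - gen_binom n (remove_box p l) m \<in> nonneg_cone"
  using assms(3-5)
proof (induction "psize n l" arbitrary: l p rule: less_induct)
  case (less l p)
  note l = less.prems(1) and p = less.prems(2,3)
  define k where "k = remove_box p l"
  have k: "k \<in> partitions n" and size: "psize n l = Suc (psize n k)"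
    using remove_box_partitions[OF l p] psize_remove_box[of p n l] p by (auto simp: k_def)
  show ?case
  proof (cases "psize n l \<le> psize n m")
    case True
    then have "gen_binom n k m = 0"
      using gen_binom_small[OF k m] size by auto
    moreover have "gen_binom n l m \<in> nonneg_cone"
      using gen_binom_small[OF l m True] cone_0 cone_1 by simp
    ultimately show ?thesis by (simp add: k_def)
  next
    case False
    define d where "d = psize n l - psize n m"
    have d: "0 < d" "(of_nat (psize n l) :: base_field) - of_nat (psize n m) = of_nat d"
      using False by (auto simp: d_def of_nat_diff)
    have d1: "(of_nat (psize n k) :: base_field) - of_nat (psize n m) = of_nat d - 1"
      using d size by (simp add: algebra_simps)
    let ?f = "\<lambda>l. gen_binom n l m" and ?w = "\<lambda>i l. weight n i l"
    define T where "T i = ?w i l * (?f (remove_box i l) - ?f k) + ?w i k * (?f k - ?f (remove_box i k))" for i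
    let ?X = "\<Sum>i=1..n. ?w i l * ?f (remove_box i l)" and ?Y = "\<Sum>i=1..n. ?w i k * ?f (remove_box i k)"
    have "?f k = of_nat (psize n l) * ?f k - of_nat (psize n k) * ?f k"
      by (simp add: size algebra_simps)
    also have "\<dots> = (\<Sum>i=1..n. ?w i l) * ?f k - (\<Sum>i=1..n. ?w i k) * ?f k"
      unfolding sum_weight[OF n l] sum_weight[OF n k] ..
    finally have fk: "?f k = (\<Sum>i=1..n. ?w i l) * ?f k - (\<Sum>i=1..n. ?w i k) * ?f k" .
    have "of_nat d * (?f l - ?f k) = of_nat d * ?f l - (?f k + (of_nat d - 1) * ?f k)"
      by (simp add: algebra_simps)
    also have "\<dots> = ?X - (?f k + ?Y)"
      using gen_binom_recursion[OF n l m] gen_binom_recursion[OF n k m] d d1 by simp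
    also have "\<dots> = ?X - (((\<Sum>i=1..n. ?w i l) * ?f k - (\<Sum>i=1..n. ?w i k) * ?f k) + ?Y)"
      by (rule arg_cong[OF fk])
    finally have eq: "of_nat d * (?f l - ?f k) = (\<Sum>i=1..n. T i)"
      by (simp add: T_def sum.distrib sum_subtractf right_diff_distrib sum_distrib_right)
    have "T i \<in> nonneg_cone" if i: "i \<in> {1..n}" for i
    proof -
      have k_step: "?f k - ?f (remove_box i k) \<in> nonneg_cone" if "k (Suc i) < k i"
        using less.hyps[OF _ k i that] size by simp
      show ?thesis
      proof (cases "i = p")
        case True
        \<comment> \<open>For \<open>i = p\<close> the first difference in \<open>T i\<close> is zero.\<close>
        have "?w i k * (?f k - ?f (remove_box i k)) \<in> nonneg_cone"
          using k_step cone_weight[OF k i] weight_eq_0[OF k i] cone_0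
          by (cases "k (Suc i) < k i") (auto intro: cone_mult)
        then show ?thesis
          using True by (simp add: T_def k_def)
      next
        case False
        show ?thesis
        proof (cases "k (Suc i) < k i")
          case corner: True
          have ki: "?w i k * (?f k - ?f (remove_box i k)) \<in> nonneg_cone"
            by (intro cone_mult cone_weight k i k_step corner)
          show ?thesis
          proof (cases "l (Suc i) < l i")
            case True
            have li: "remove_box i l \<in> partitions n" "psize n (remove_box i l) < psize n l"
              using remove_box_partitions[OF l i True] psize_remove_box[OF i, of l] True by auto
            \<comment> \<open>The square formed by \<open>l\<close>, \<open>l - e\<^sub>i\<close>, \<open>k\<close> and \<open>k - e\<^sub>i\<close>: differences along its two opposite sides
              are compared.\<close>
            have swap: "remove_box p (remove_box i l) = remove_box i k"
              using False by (auto simp: remove_box_def k_def fun_eq_iff)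
            have "remove_box i l (Suc p) < remove_box i l p"
              using False p(2) by (auto simp: remove_box_def)
            then have "?f (remove_box i l) - ?f (remove_box i k) \<in> nonneg_cone"
              using less.hyps[OF li(2,1) p(1)] swap by simp
            moreover have "?w i k - ?w i l \<in> nonneg_cone"
              unfolding k_def using cone_weight_remove_box_diff[OF l p i False] .
            ultimately have "?w i l * (?f (remove_box i l) - ?f (remove_box i k))
                + (?w i k - ?w i l) * (?f k - ?f (remove_box i k)) \<in> nonneg_cone"
              by (intro cone_add cone_mult cone_weight l i k_step corner)
            then show ?thesis
              by (simp add: T_def algebra_simps)
          next
            case False
            then show ?thesis
              using ki by (simp add: T_def weight_eq_0[OF l i])
          qed
        next
          case no: False
          \<comment> \<open>A corner of \<open>l\<close> other than the removed one is still a corner of \<open>k\<close>.\<close>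
          have "\<not> l (Suc i) < l i"
            using no False p(2) by (auto simp: k_def remove_box_def split: if_splits)
          then show ?thesis
            using no by (simp add: T_def weight_eq_0[OF l i] weight_eq_0[OF k i] cone_0)
        qed
      qed
    qed
    then have "(of_nat d * (?f l - ?f k)) / of_nat d \<in> nonneg_cone"
      unfolding eq by (intro cone_divide cone_sum cone_of_nat)
    then show ?thesis
      using of_nat_base_field_neq_0[OF d(1)] by (simp add: k_def)
  qed
qed

theorem theorem2:
  fixes n :: nat and lam mu :: "nat \<Rightarrow> nat"
  assumes "n \<ge> 1"
    and "lam \<in> partitions n" and "mu \<in> partitions n"
    and "\<forall>i\<in>{1..n}. mu i \<le> lam i"
  shows "\<forall>nu\<in>partitions n. gen_binom n lam nu - gen_binom n mu nu \<in> nonneg_cone"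
proof
  fix nu assume nu: "nu \<in> partitions n"
  from assms(2,4) show "gen_binom n lam nu - gen_binom n mu nu \<in> nonneg_cone"
  proof (induction "psize n lam" arbitrary: lam rule: less_induct)
    case (less lam)
    show ?case
    proof (cases "lam = mu")
      case True
      then show ?thesis by (simp add: cone_0)
    next
      case False
      define D where "D = {i \<in> {1..n}. mu i < lam i}"
      have "D \<noteq> {}"
        using False partitions_eqI[OF less.prems(1) assms(3)] less.prems(2)
        by (force simp: D_def)
      \<comment> \<open>The lowest row in which \<open>lam\<close> and \<open>mu\<close> differ ends in a corner of \<open>lam\<close>, and removing it keeps \<open>mu\<close>
        inside.\<close>
      define p where "p = Max D"
      have "finite D" by (simp add: D_def)
      then have "p \<in> D" and max: "\<And>i. i \<in> D \<Longrightarrow> i \<le> p"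
        using \<open>D \<noteq> {}\<close> by (auto simp: p_def)
      then have p: "p \<in> {1..n}" "mu p < lam p"
        by (auto simp: D_def)
      have "lam (Suc p) \<le> mu (Suc p)"
        using max[of "Suc p"] partitions_outside[OF less.prems(1), of "Suc p"]
        by (cases "Suc p \<in> {1..n}") (auto simp: D_def intro: leI)
      also have "\<dots> \<le> mu p"
        using partitions_antimono[OF assms(3), of p "Suc p"] p by simp
      finally have corner: "lam (Suc p) < lam p"
        using p by simp
      let ?k = "remove_box p lam"
      have "gen_binom n ?k nu - gen_binom n mu nu \<in> nonneg_cone"
      proof (rule less.hyps)
        show "psize n ?k < psize n lam"
          using psize_remove_box[OF p(1), of lam] p by simp
        show "?k \<in> partitions n"
          by (rule remove_box_partitions[OF less.prems(1) p(1) corner])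
        show "\<forall>i\<in>{1..n}. mu i \<le> ?k i"
          using less.prems(2) p(2) by (auto simp: remove_box_def)
      qed
      from cone_add[OF gen_binom_remove_box_mono[OF assms(1) nu less.prems(1) p(1) corner] this]
      show ?thesis by simp
    qed
  qed
qed

end
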